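(* Every semi-algebraic set $X\subset\mathbb{R}^n$ is nearly radial at each of its points.
   Context: A set is semi-algebraic if it is a finite union of sets defined by finitely many polynomial equalities and inequalities. The tangent cone is $T_X(x)=\{\lim t_r^{-1}(x_r-x):t_r\downarrow0,\ x_r\to x,\ x_r\in X\}$. $X$ is nearly radial at $\bar x\in X$ if $\operatorname{dist}\big(\tfrac{\bar x-x}{\|\bar x-x\|},T_X(x)\big)\to0$ as $x\to\bar x$, $x\in X$, $x\ne\bar x$ (equivalently $\operatorname{dist}(\bar x,x+T_X(x))=o(\|x-\bar x\|)$). *)

theory Defs
  imports "HOL-Analysis.Analysis"
begin

inductive real_poly_fun :: "(real ^ 'n \<Rightarrow> real) \<Rightarrow> bool" where
  const: "real_poly_fun (\<lambda>x. c)"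
| coord: "real_poly_fun (\<lambda>x. x $ i)"
| add: "real_poly_fun p \<Longrightarrow> real_poly_fun q \<Longrightarrow> real_poly_fun (\<lambda>x. p x + q x)"
| mult: "real_poly_fun p \<Longrightarrow> real_poly_fun q \<Longrightarrow> real_poly_fun (\<lambda>x. p x * q x)"

definition basic_semialgebraic :: "(real ^ 'n) set \<Rightarrow> bool" where
  "basic_semialgebraic S \<longleftrightarrow>
     (\<exists>E G P. finite E \<and> finite G \<and> finite P \<and>
        (\<forall>p\<in>E \<union> G \<union> P. real_poly_fun p) \<and>
        S = {x. (\<forall>p\<in>E. p x = 0) \<and> (\<forall>p\<in>G. p x \<ge> 0) \<and> (\<forall>p\<in>P. p x > 0)})"

definition semialgebraic :: "(real ^ 'n) set \<Rightarrow> bool" where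
  "semialgebraic X \<longleftrightarrow> (\<exists>\<F>. finite \<F> \<and> (\<forall>S\<in>\<F>. basic_semialgebraic S) \<and> X = \<Union>\<F>)"

definition tangent_cone :: "(real ^ 'n) set \<Rightarrow> real ^ 'n \<Rightarrow> (real ^ 'n) set" where
  "tangent_cone X x = {v. \<exists>t y. (\<forall>r. t r > 0 \<and> y r \<in> X) \<and> t \<longlonglongrightarrow> 0 \<and> y \<longlonglongrightarrow> x \<and>
        (\<lambda>r. (1 / t r) *\<^sub>R (y r - x)) \<longlonglongrightarrow> v}"

definition nearly_radial :: "(real ^ 'n) set \<Rightarrow> real ^ 'n \<Rightarrow> bool" where
  "nearly_radial X xb \<longleftrightarrow> xb \<in> X \<and>
     ((\<lambda>x. infdist ((1 / norm (xb - x)) *\<^sub>R (xb - x)) (tangent_cone X x)) \<longlongrightarrow> 0)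
       (at xb within X)"

end

theory Submission
  imports Defs
begin

text \<open>If \<open>X\<close> is not nearly radial at \<open>xb\<close>, then for some \<open>\<epsilon> > 0\<close> there are points \<open>x \<in> X\<close> arbitrarily
  close to \<open>xb\<close> at which \<open>X\<close> avoids a small cone around the direction of \<open>xb - x\<close>. These bad points form a
  semialgebraic set by Tarski--Seidenberg, so definable choice provides bad points
  \<open>x r = xb + r \<omega>(r)\<close>, for all small \<open>r > 0\<close>, with \<open>\<omega>\<close> semialgebraic of norm one. The left
  difference quotients of a bounded semialgebraic function of \<open>r\<close> are \<open>o(1 / r)\<close> as \<open>r\<close> tends to \<open>0\<close>,
  so for small \<open>h > 0\<close> the points \<open>x (r - h)\<close> of \<open>X\<close> enter the cone at \<open>x r\<close>, a contradiction.
  Secants suffice: no differentiability of the curve and no stratification is used.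

  The quantifier elimination follows Hoermander: once a finite family of polynomials with
  parameters is closed under derivatives, truncations and pseudo-remainders, the signs of its
  constant members determine the sign pattern of the whole family on the line up to an increasing
  bijection.\<close>

section \<open>Order isomorphisms of the line matching polynomial signs\<close>

text \<open>Parametrising by the distance makes the radial part cancel: subtracting
  \<open>h / r\<close> times \<open>xb - x r\<close> from the secant \<open>x (r - h) - x r\<close>
  leaves exactly \<open>- (r - h)\<close> times \<open>\<omega>(r) - \<omega>(r - h)\<close>.
  Avoiding the cone forces this to have norm at least \<open>\<epsilon> * h\<close>, whereas slow
  variation of the coordinates of \<omega> bounds it by half of that. The secant goes to the left
  because \<open>xb\<close> lies towards smaller \<open>r\<close>. The obstacle is that the curve
  comes from a choice, so nothing is known of it beyond definability, not even continuity. All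
  regularity is drawn from one finiteness fact: a semialgebraic property of a real number changes
  its truth value at finitely many places only.\<close>

lemma real_interval_bump:
  fixes A B c c' :: real
  assumes "A < c" "c < B" "A < c'" "c' < B"
  obtains g where "strict_mono g" "surj g" "g c = c'" "\<And>t. t \<notin> {A<..<B} \<Longrightarrow> g t = t"
proof -
  define a where "a = (c' - A) / (c - A)"
  define b where "b = (B - c') / (B - c)"
  have ab: "a > 0" "b > 0" "(c - A) * a = c' - A" "(B - c) * b = B - c'"
    using assms by (auto simp: a_def b_def)
  define g where "g t = (if t \<le> A \<or> B \<le> t then t else if t \<le> c then A + (t - A) * a else B - (B - t) * b)" for t
  have low: "A < A + (t - A) * a" "A + (t - A) * a \<le> c'" if "A < t" "t \<le> c" for t
    using that ab mult_right_mono[of "t - A" "c - A" a] by auto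
  have high: "B - (B - t) * b < B" "c' < B - (B - t) * b" if "c < t" "t < B" for t
    using that ab mult_strict_right_mono[of "B - t" "B - c" b] by auto
  have "strict_mono g"
  proof (rule strict_monoI)
    fix x y :: real assume xy: "x < y"
    have "(x - A) * a < (y - A) * a" "(B - y) * b < (B - x) * b"
      using xy ab by auto
    then show "g x < g y"
      using xy assms low[of x] low[of y] high[of x] high[of y] by (auto simp: g_def)
  qed
  moreover have "surj g"
    unfolding surj_def
  proof (rule allI)
    fix s :: real
    consider "s \<le> A \<or> B \<le> s" | "A < s" "s \<le> c'" | "c' < s" "s < B" by linarith
    then show "\<exists>t. s = g t"
    proof cases
      case 1 then show ?thesis by (intro exI[of _ s]) (auto simp: g_def)
    next
      case 2
      have "A + (s - A) / a \<le> c"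
        using 2 ab by (simp add: field_simps)
      moreover have "A < A + (s - A) / a" using 2 ab by simp
      ultimately show ?thesis using assms ab by (intro exI[of _ "A + (s - A) / a"]) (auto simp: g_def)
    next
      case 3
      have "c < B - (B - s) / b"
        using 3 ab by (simp add: field_simps)
      moreover have "B - (B - s) / b < B" using 3 ab by simp
      ultimately show ?thesis using assms ab by (intro exI[of _ "B - (B - s) / b"]) (auto simp: g_def)
    qed
  qed
  moreover have "g c = c'" "\<And>t. t \<notin> {A<..<B} \<Longrightarrow> g t = t"
    using assms ab by (auto simp: g_def)
  ultimately show ?thesis using that by blast
qed

lemma poly_sgn_const_closed:
  fixes p :: "real poly"
  assumes nz: "\<And>z. x \<le> z \<Longrightarrow> z \<le> y \<Longrightarrow> poly p z \<noteq> 0" and "x < y"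
  shows "sgn (poly p x) = sgn (poly p y)"
proof (rule ccontr)
  assume ne: "sgn (poly p x) \<noteq> sgn (poly p y)"
  have "poly p x \<noteq> 0" "poly p y \<noteq> 0" using nz \<open>x < y\<close> by auto
  with ne have "poly p x * poly p y < 0"
    by (auto simp: sgn_if mult_less_0_iff split: if_splits)
  then obtain z where "z > x" "z < y" "poly p z = 0" using poly_IVT \<open>x < y\<close> by blast
  then show False using nz[of z] by auto
qed

lemma poly_sgn_const:
  fixes p :: "real poly"
  assumes nz: "\<And>z. a < z \<Longrightarrow> z < b \<Longrightarrow> poly p z \<noteq> 0"
    and "a < x" "x < b" "a < y" "y < b"
  shows "sgn (poly p x) = sgn (poly p y)"
proof -
  have "sgn (poly p x) = sgn (poly p y)" if "x < y" "a < x" "y < b" for x y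
    by (rule poly_sgn_const_closed) (use nz that in auto)
  then show ?thesis using assms by (metis linorder_neqE_linordered_idom)
qed

lemma poly_strict_incr:
  fixes p :: "real poly"
  assumes "\<And>z. a < z \<Longrightarrow> z < b \<Longrightarrow> poly (pderiv p) z > 0" "a \<le> x" "x < y" "y \<le> b"
  shows "poly p x < poly p y"
proof -
  obtain z where "x < z" "z < y" "poly p y - poly p x = (y - x) * poly (pderiv p) z"
    using poly_MVT[OF \<open>x < y\<close>] by blast
  moreover have "poly (pderiv p) z > 0" using assms calculation by auto
  ultimately show ?thesis using assms by (metis diff_gt_0_iff_gt mult_pos_pos)
qed

text \<open>A pair in \<open>A\<close> is meant to hold one polynomial at two parameter values. A
  strictly increasing surjection of the line is a homeomorphism, so gaps between roots go to gaps
  between roots.\<close>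

definition sign_iso :: "(real \<Rightarrow> real) \<Rightarrow> (real poly \<times> real poly) set \<Rightarrow> bool" where
  "sign_iso \<phi> A \<longleftrightarrow> strict_mono \<phi> \<and> surj \<phi> \<and>
     (\<forall>(S, T)\<in>A. \<forall>y. sgn (poly S y) = sgn (poly T (\<phi> y)))"

lemma sign_isoD:
  assumes "sign_iso \<phi> A"
  shows "strict_mono \<phi>" "surj \<phi>" "(S, T) \<in> A \<Longrightarrow> sgn (poly S y) = sgn (poly T (\<phi> y))"
  using assms by (auto simp: sign_iso_def)

text \<open>No nonzero first component vanishes between \<open>l\<close> and \<open>h\<close>, so
  both components of a pair keep their signs there and the values of \<phi> inside can be
  redistributed. This frees the image of a single point.\<close>

lemma sign_iso_move:
  assumes iso: "sign_iso \<phi> A" and "l < w" "w < h" "\<phi> l < w'" "w' < \<phi> h"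
    and nz: "\<And>S T z. (S, T) \<in> A \<Longrightarrow> S \<noteq> 0 \<Longrightarrow> l < z \<Longrightarrow> z < h \<Longrightarrow> poly S z \<noteq> 0"
  obtains \<psi> where "sign_iso \<psi> A" "\<psi> w = w'" "\<And>y. y \<notin> {l<..<h} \<Longrightarrow> \<psi> y = \<phi> y"
proof -
  note \<phi> = sign_isoD[OF iso]
  have less: "\<phi> x < \<phi> y \<longleftrightarrow> x < y" for x y
    using \<phi>(1) by (simp add: strict_mono_less)
  obtain g where g: "strict_mono g" "surj g" "g (\<phi> w) = w'" "\<And>t. t \<notin> {\<phi> l<..<\<phi> h} \<Longrightarrow> g t = t"
    using real_interval_bump[of "\<phi> l" "\<phi> w" "\<phi> h" w'] assms less by metis
  define \<psi> where "\<psi> = g \<circ> \<phi>"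
  have mono: "strict_mono \<psi>" using g(1) \<phi>(1) by (simp add: \<psi>_def strict_mono_def)
  have surj: "surj \<psi>" unfolding \<psi>_def using g(2) \<phi>(2) by (rule comp_surj[rotated])
  have out: "\<psi> y = \<phi> y" if "y \<notin> {l<..<h}" for y
    using that g(4)[of "\<phi> y"] by (auto simp: \<psi>_def less)
  have "sgn (poly S y) = sgn (poly T (\<psi> y))" if ST: "(S, T) \<in> A" for S T y
  proof (cases "y \<in> {l<..<h} \<and> S \<noteq> 0")
    case False
    then show ?thesis
    proof (cases "S = 0")
      case True
      then have "poly T (\<phi> x) = 0" for x using \<phi>(3)[OF ST, of x] by (simp add: sgn_zero_iff)
      then have "poly T x = 0" for x using \<phi>(2) by (metis surjD)
      then show ?thesis using True by simp
    next
      case F: False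
      then show ?thesis using False out \<phi>(3)[OF ST, of y] by auto
    qed
  next
    case True
    have "\<psi> l < \<psi> y" "\<psi> y < \<psi> h" using mono True by (auto simp: strict_mono_def)
    then have *: "\<phi> l < \<psi> y" "\<psi> y < \<phi> h" using out[of l] out[of h] by auto
    have nT: "poly T z \<noteq> 0" if "\<phi> l < z" "z < \<phi> h" for z
    proof -
      obtain x where x: "z = \<phi> x" using \<phi>(2) by (metis surjD)
      then show ?thesis using nz[OF ST, of x] that True \<phi>(3)[OF ST, of x] less by (auto simp: sgn_zero_iff)
    qed
    have "\<phi> l < \<phi> y" "\<phi> y < \<phi> h" using True less by auto
    with poly_sgn_const[OF nT *] have "sgn (poly T (\<psi> y)) = sgn (poly T (\<phi> y))" by blast
    then show ?thesis using \<phi>(3)[OF ST, of y] by simp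
  qed
  then have "sign_iso \<psi> A" using mono surj by (auto simp: sign_iso_def)
  moreover have "\<psi> w = w'" using g(3) by (simp add: \<psi>_def)
  ultimately show ?thesis using that out by blast
qed

text \<open>Both polynomials increase strictly between the end points, so each has at most one zero
  inside, and the end signs tell whether it has one. The first conclusion supplies the root to which
  \<phi> has to be redirected; the second checks the signs once this has been done.\<close>

lemma poly_crossing_incr:
  fixes P Q :: "real poly"
  assumes \<phi>: "strict_mono \<phi>" "surj \<phi>"
    and P: "\<And>z. l < z \<Longrightarrow> z < h \<Longrightarrow> poly (pderiv P) z > 0"
    and Q: "\<And>z. \<phi> l < z \<Longrightarrow> z < \<phi> h \<Longrightarrow> poly (pderiv Q) z > 0"
    and sl: "sgn (poly P l) = sgn (poly Q (\<phi> l))" and sh: "sgn (poly P h) = sgn (poly Q (\<phi> h))"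
    and y: "l < y" "y < h"
  shows "poly P y = 0 \<Longrightarrow> \<exists>w. \<phi> l < w \<and> w < \<phi> h \<and> poly Q w = 0"
    and "(\<And>u. l < u \<Longrightarrow> u < h \<Longrightarrow> poly P u = 0 \<Longrightarrow> poly Q (\<phi> u) = 0) \<Longrightarrow>
           sgn (poly P y) = sgn (poly Q (\<phi> y))"
proof -
  have less: "\<phi> x < \<phi> y \<longleftrightarrow> x < y" "\<phi> x \<le> \<phi> y \<longleftrightarrow> x \<le> y" for x y
    using \<phi>(1) by (simp_all add: strict_mono_less strict_mono_less_eq)
  have Pi: "poly P a < poly P b" if "l \<le> a" "a < b" "b \<le> h" for a b
    using poly_strict_incr[OF P that] .
  have Qi: "poly Q (\<phi> a) < poly Q (\<phi> b)" if "l \<le> a" "a < b" "b \<le> h" for a b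
    using poly_strict_incr[OF Q, where x="\<phi> a" and y="\<phi> b"] that less by auto
  show "\<exists>w. \<phi> l < w \<and> w < \<phi> h \<and> poly Q w = 0" if "poly P y = 0"
  proof -
    have "poly P l < 0" "poly P h > 0" using Pi[of l y] Pi[of y h] y that by auto
    then have "poly Q (\<phi> l) < 0" "poly Q (\<phi> h) > 0" using sl sh by (auto simp: sgn_if split: if_splits)
    then show ?thesis using poly_IVT_pos[of "\<phi> l" "\<phi> h" Q] less y by auto
  qed
  show "sgn (poly P y) = sgn (poly Q (\<phi> y))"
    if root: "\<And>u. l < u \<Longrightarrow> u < h \<Longrightarrow> poly P u = 0 \<Longrightarrow> poly Q (\<phi> u) = 0"
  proof -
    consider "poly P l \<ge> 0" | "poly P h \<le> 0" | "poly P l < 0" "poly P h > 0" by linarith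
    then show ?thesis
    proof cases
      case 1
      then have "poly Q (\<phi> l) \<ge> 0" using sl by (auto simp: sgn_if split: if_splits)
      then show ?thesis using 1 Pi[of l y] Qi[of l y] y by auto
    next
      case 2
      then have "poly Q (\<phi> h) \<le> 0" using sh by (auto simp: sgn_if split: if_splits)
      then show ?thesis using 2 Pi[of y h] Qi[of y h] y by auto
    next
      case 3
      then obtain u where u: "l < u" "u < h" "poly P u = 0"
        using poly_IVT_pos[of l h P] y by auto
      have "poly Q (\<phi> u) = 0" using root u by blast
      then show ?thesis using u y Pi[of y u] Qi[of y u] Pi[of u y] Qi[of u y]
        by (cases y u rule: linorder_cases) auto
    qed
  qed
qed

text \<open>The derivative has one sign between \<open>l\<close> and \<open>h\<close>, and \<phi>
  transfers it to \<open>Q\<close>; negating both polynomials reduces the decreasing case to the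
  increasing one.\<close>

lemma poly_crossing:
  fixes P Q :: "real poly"
  assumes \<phi>: "strict_mono \<phi>" "surj \<phi>"
    and der: "\<And>z. sgn (poly (pderiv P) z) = sgn (poly (pderiv Q) (\<phi> z))"
    and nz: "\<And>z. l < z \<Longrightarrow> z < h \<Longrightarrow> poly (pderiv P) z \<noteq> 0"
    and sl: "sgn (poly P l) = sgn (poly Q (\<phi> l))" and sh: "sgn (poly P h) = sgn (poly Q (\<phi> h))"
    and y: "l < y" "y < h"
  shows "poly P y = 0 \<Longrightarrow> \<exists>w. \<phi> l < w \<and> w < \<phi> h \<and> poly Q w = 0"
    and "(\<And>u. l < u \<Longrightarrow> u < h \<Longrightarrow> poly P u = 0 \<Longrightarrow> poly Q (\<phi> u) = 0) \<Longrightarrow>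
           sgn (poly P y) = sgn (poly Q (\<phi> y))"
proof -
  let ?th1 = "\<exists>w. \<phi> l < w \<and> w < \<phi> h \<and> poly Q w = 0" and ?th2 = "sgn (poly P y) = sgn (poly Q (\<phi> y))"
  have less: "\<phi> x < \<phi> y \<longleftrightarrow> x < y" for x y
    using \<phi>(1) by (simp add: strict_mono_less)
  have const: "sgn (poly (pderiv P) z) = sgn (poly (pderiv P) y)" if "l < z" "z < h" for z
    using poly_sgn_const[OF nz] that y by blast
  have ny: "poly (pderiv P) y \<noteq> 0" using nz y by blast
  have Q: "sgn (poly (pderiv Q) z) = sgn (poly (pderiv P) y)" if "\<phi> l < z" "z < \<phi> h" for z
  proof -
    obtain x where "z = \<phi> x" using \<phi>(2) by (metis surjD)
    then show ?thesis using that less der[of x] const[of x] by auto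
  qed
  have "(poly P y = 0 \<longrightarrow> ?th1) \<and> ((\<forall>u. l < u \<longrightarrow> u < h \<longrightarrow> poly P u = 0 \<longrightarrow> poly Q (\<phi> u) = 0) \<longrightarrow> ?th2)"
  proof (cases "poly (pderiv P) y > 0")
    case True
    have 1: "poly (pderiv P) z > 0" if "l < z" "z < h" for z
      using const[OF that] True by (simp add: sgn_1_pos)
    have 2: "poly (pderiv Q) z > 0" if "\<phi> l < z" "z < \<phi> h" for z
      using Q[OF that] True by (simp add: sgn_1_pos)
    show ?thesis using poly_crossing_incr[OF \<phi> 1 2 sl sh y] by blast
  next
    case False
    then have neg: "poly (pderiv P) y < 0" using ny by linarith
    have 1: "poly (pderiv (- P)) z > 0" if "l < z" "z < h" for z
      using const[OF that] neg by (simp add: pderiv_minus sgn_1_neg)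
    have 2: "poly (pderiv (- Q)) z > 0" if "\<phi> l < z" "z < \<phi> h" for z
      using Q[OF that] neg by (simp add: pderiv_minus sgn_1_neg)
    have 3: "sgn (poly (- P) l) = sgn (poly (- Q) (\<phi> l))" "sgn (poly (- P) h) = sgn (poly (- Q) (\<phi> h))"
      using sl sh by (simp_all add: sgn_minus)
    show ?thesis using poly_crossing_incr[OF \<phi> 1 2 3 y] by (auto simp: sgn_minus)
  qed
  then show "poly P y = 0 \<Longrightarrow> ?th1"
    and "(\<And>u. l < u \<Longrightarrow> u < h \<Longrightarrow> poly P u = 0 \<Longrightarrow> poly Q (\<phi> u) = 0) \<Longrightarrow> ?th2"
    by blast+
qed

lemma poly_sgn_at_top:
  fixes P :: "real poly"
  assumes "P \<noteq> 0"
  shows "\<exists>K. \<forall>y\<ge>K. sgn (poly P y) = sgn (lead_coeff P)"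
proof -
  have *: "\<exists>K. \<forall>y\<ge>K. poly P y > 0" if "lead_coeff P > 0" for P :: "real poly"
    using poly_pinfty_gt_lc[OF that] that by (meson less_le_trans)
  consider "lead_coeff P > 0" | "lead_coeff P < 0" using assms by (metis leading_coeff_0_iff linorder_neqE_linordered_idom)
  then show ?thesis
  proof cases
    case 1 then show ?thesis using *[OF 1] by (metis sgn_pos)
  next
    case 2
    then obtain K where "\<forall>y\<ge>K. poly P y < 0" using *[of "-P"] by auto
    then show ?thesis using 2 by (metis sgn_neg)
  qed
qed

lemma poly_sgn_at_bot:
  fixes P :: "real poly"
  assumes "P \<noteq> 0"
  shows "\<exists>K. \<forall>y\<le>K. sgn (poly P y) = sgn (lead_coeff P) * (-1) ^ degree P"
proof -
  let ?R = "P \<circ>\<^sub>p [:0, -1:]"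
  have sgn_neg1: "sgn (lead_coeff P * (-1) ^ degree P) = sgn (lead_coeff P) * (-1) ^ degree P"
    by (cases "even (degree P)") (auto simp: sgn_minus)
  have lc: "lead_coeff ?R = lead_coeff P * (-1) ^ degree P"
    by (subst lead_coeff_comp) auto
  then have "?R \<noteq> 0" using assms by auto
  then obtain K where K: "\<And>y. y \<ge> K \<Longrightarrow> sgn (poly ?R y) = sgn (lead_coeff P) * (-1) ^ degree P"
    using poly_sgn_at_top[of ?R] lc sgn_neg1 by auto
  show ?thesis
  proof (intro exI allI impI)
    fix y assume "y \<le> - K"
    then show "sgn (poly P y) = sgn (lead_coeff P) * (-1) ^ degree P"
      using K[of "-y"] by (simp add: poly_pcompose)
  qed
qed

text \<open>Avoids a separate treatment of unbounded gaps of \<open>Z\<close>: if no point of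
  \<open>Z\<close> lies to the left of \<open>u\<close>, a point far enough left serves as end
  point, since both sign functions have settled to \<open>s\<close> there.\<close>

lemma bracket_below:
  fixes P Q :: "real \<Rightarrow> real"
  assumes \<phi>: "strict_mono \<phi>" "surj \<phi>" and Z: "finite Z"
    and eq: "\<And>z. z \<in> Z \<Longrightarrow> P z = Q (\<phi> z)"
    and inf: "\<And>y. y \<le> K \<Longrightarrow> P y = s" "\<And>y. y \<le> K \<Longrightarrow> Q y = s"
  obtains l where "l < u" "{l<..<u} \<inter> Z = {}" "P l = Q (\<phi> l)"
proof (cases "Z \<inter> {..<u} = {}")
  case True
  obtain k where k: "\<phi> k = K" using \<phi>(2) by (metis surjD)
  \<comment> \<open>\<open>k\<close> enters because \<open>Q\<close> is evaluated at
    \<open>\<phi> l\<close>, which must lie below \<open>K\<close> as well.\<close>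
  define l where "l = Min {k, K, u - 1}"
  have l: "l \<le> k" "l \<le> K" "l < u" by (auto simp: l_def)
  then have "\<phi> l \<le> K" using k \<phi>(1) by (metis strict_mono_less_eq)
  then have "P l = Q (\<phi> l)" using inf l by simp
  then show ?thesis using that l True by fastforce
next
  case False
  define l where "l = Max (Z \<inter> {..<u})"
  have fin: "finite (Z \<inter> {..<u})" using Z by auto
  have "l \<in> Z \<inter> {..<u}" unfolding l_def using Max_in[OF fin False] .
  moreover have "z \<le> l" if "z \<in> Z" "z < u" for z
    unfolding l_def using that fin by (auto intro: Max_ge)
  ultimately show ?thesis using that[of l] eq[of l] by fastforce
qed

lemma bracket_above:
  fixes P Q :: "real \<Rightarrow> real"
  assumes \<phi>: "strict_mono \<phi>" "surj \<phi>" and Z: "finite Z"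
    and eq: "\<And>z. z \<in> Z \<Longrightarrow> P z = Q (\<phi> z)"
    and inf: "\<And>y. y \<ge> K \<Longrightarrow> P y = s" "\<And>y. y \<ge> K \<Longrightarrow> Q y = s"
  obtains h where "u < h" "{u<..<h} \<inter> Z = {}" "P h = Q (\<phi> h)"
proof (cases "Z \<inter> {u<..} = {}")
  case True
  obtain k where k: "\<phi> k = K" using \<phi>(2) by (metis surjD)
  define h where "h = Max {k, K, u + 1}"
  have h: "k \<le> h" "K \<le> h" "u < h" by (auto simp: h_def)
  then have "\<phi> h \<ge> K" using k \<phi>(1) by (metis strict_mono_less_eq)
  then have "P h = Q (\<phi> h)" using inf h by simp
  then show ?thesis using that h True by fastforce
next
  case False
  define h where "h = Min (Z \<inter> {u<..})"
  have fin: "finite (Z \<inter> {u<..})" using Z by auto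
  have "h \<in> Z \<inter> {u<..}" unfolding h_def using Min_in[OF fin False] .
  moreover have "h \<le> z" if "z \<in> Z" "u < z" for z
    unfolding h_def using that fin by (auto intro: Min_le)
  ultimately show ?thesis using that[of h] eq[of h] by fastforce
qed

text \<open>The inductive step. \<open>rem\<close> matches signs at the roots of earlier members,
  degree and leading coefficient match them near infinity, and in the gaps between those roots
  \<open>P\<close> is strictly monotone because its derivative is an earlier member. Hence \<phi>
  needs changing only to redirect the roots of \<open>P\<close> lying in the gaps.\<close>

lemma sign_iso_insert:
  assumes "finite A" and iso: "sign_iso \<phi> A"
    and deg: "degree P > 0" "degree P = degree Q" and lc: "sgn (lead_coeff P) = sgn (lead_coeff Q)"
    and der: "(pderiv P, pderiv Q) \<in> A"
    and rem: "\<And>S T z. (S, T) \<in> A \<Longrightarrow> S \<noteq> 0 \<Longrightarrow> poly S z = 0 \<Longrightarrow> sgn (poly P z) = sgn (poly Q (\<phi> z))"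
  shows "\<exists>\<psi>. sign_iso \<psi> (insert (P, Q) A)"
proof -
  define Z where "Z = (\<Union>(S, T)\<in>A. if S = 0 then {} else {z. poly S z = 0})"
  have Z: "finite Z" unfolding Z_def using \<open>finite A\<close> by (auto simp: poly_roots_finite)
  have ZI: "z \<in> Z" if "(S, T) \<in> A" "S \<noteq> 0" "poly S z = 0" for S T z
    using that by (force simp: Z_def)
  have Zeq: "sgn (poly P z) = sgn (poly Q (\<phi> z))" if "z \<in> Z" for z
    using that rem by (auto simp: Z_def split: if_splits)
  have P0: "P \<noteq> 0" "Q \<noteq> 0" using deg by auto
  have dP: "pderiv P \<noteq> 0" using deg by (simp add: pderiv_eq_0_iff)
  define W where "W = {w. poly P w = 0} - Z"
  have W: "finite W" unfolding W_def using P0 by (simp add: poly_roots_finite)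
  obtain K1 where K1: "\<And>y. y \<le> K1 \<Longrightarrow> sgn (poly P y) = sgn (lead_coeff P) * (-1) ^ degree P"
     "\<And>y. y \<le> K1 \<Longrightarrow> sgn (poly Q y) = sgn (lead_coeff P) * (-1) ^ degree P"
  proof -
    obtain a b where "\<forall>y\<le>a. sgn (poly P y) = sgn (lead_coeff P) * (-1) ^ degree P"
        "\<forall>y\<le>b. sgn (poly Q y) = sgn (lead_coeff Q) * (-1) ^ degree Q"
      using poly_sgn_at_bot P0 by metis
    then show ?thesis using that[of "min a b"] deg lc by auto
  qed
  obtain K2 where K2: "\<And>y. y \<ge> K2 \<Longrightarrow> sgn (poly P y) = sgn (lead_coeff P)"
     "\<And>y. y \<ge> K2 \<Longrightarrow> sgn (poly Q y) = sgn (lead_coeff P)"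
  proof -
    obtain a b where "\<forall>y\<ge>a. sgn (poly P y) = sgn (lead_coeff P)"
        "\<forall>y\<ge>b. sgn (poly Q y) = sgn (lead_coeff Q)"
      using poly_sgn_at_top P0 by metis
    then show ?thesis using that[of "max a b"] lc by auto
  qed
  \<comment> \<open>Stated for every \<psi> that agrees with \<phi> on \<open>Z\<close>, because
    \<phi> is altered one root of \<open>P\<close> at a time.\<close>
  have bracket: "\<exists>l h. l < u \<and> u < h \<and> {l<..<h} \<inter> Z = {} \<and>
      sgn (poly P l) = sgn (poly Q (\<psi> l)) \<and> sgn (poly P h) = sgn (poly Q (\<psi> h))"
    if "sign_iso \<psi> A" and ext: "\<And>z. z \<in> Z \<Longrightarrow> \<psi> z = \<phi> z" and u: "u \<notin> Z" for \<psi> u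
  proof -
    note \<psi> = sign_isoD(1,2)[OF that(1)]
    have eq: "sgn (poly P z) = sgn (poly Q (\<psi> z))" if "z \<in> Z" for z
      using Zeq ext that by auto
    obtain l where l: "l < u" "{l<..<u} \<inter> Z = {}" "sgn (poly P l) = sgn (poly Q (\<psi> l))"
      using bracket_below[of \<psi> Z "\<lambda>z. sgn (poly P z)" "\<lambda>z. sgn (poly Q z)", OF \<psi> Z eq K1] by blast
    obtain h where h: "u < h" "{u<..<h} \<inter> Z = {}" "sgn (poly P h) = sgn (poly Q (\<psi> h))"
      using bracket_above[of \<psi> Z "\<lambda>z. sgn (poly P z)" "\<lambda>z. sgn (poly Q z)", OF \<psi> Z eq K2] by blast
    have "{l<..<h} \<inter> Z = {}"
    proof (rule ccontr)
      assume "{l<..<h} \<inter> Z \<noteq> {}"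
      then obtain z where "l < z" "z < h" "z \<in> Z" by auto
      then show False using l(2) h(2) u by (cases z u rule: linorder_cases) auto
    qed
    then show ?thesis using l h by blast
  qed
  have insertU: "\<exists>\<psi>. sign_iso \<psi> A \<and> (\<forall>z\<in>Z. \<psi> z = \<phi> z) \<and> (\<forall>u\<in>U. poly Q (\<psi> u) = 0)"
    if "finite U" "U \<subseteq> W" for U
    using that
  proof (induction U rule: finite_induct)
    case empty
    then show ?case using iso by blast
  next
    case (insert u U)
    then obtain \<psi> where \<psi>: "sign_iso \<psi> A" "\<And>z. z \<in> Z \<Longrightarrow> \<psi> z = \<phi> z" "\<And>u. u \<in> U \<Longrightarrow> poly Q (\<psi> u) = 0"
      by auto
    have u: "u \<notin> Z" "poly P u = 0" using insert.prems by (auto simp: W_def)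
    obtain l h where lh: "l < u" "u < h" "{l<..<h} \<inter> Z = {}"
        "sgn (poly P l) = sgn (poly Q (\<psi> l))" "sgn (poly P h) = sgn (poly Q (\<psi> h))"
      using bracket[OF \<psi>(1,2) u(1)] by blast
    have nz: "poly S z \<noteq> 0" if "(S, T) \<in> A" "S \<noteq> 0" "l < z" "z < h" for S T z
      using ZI[of S T z] that lh(3) by auto
    obtain w where w: "\<psi> l < w" "w < \<psi> h" "poly Q w = 0"
      using poly_crossing(1)[OF sign_isoD(1,2)[OF \<psi>(1)] sign_isoD(3)[OF \<psi>(1) der] nz[OF der dP] lh(4,5,1,2) u(2)]
      by blast
    obtain \<psi>' where \<psi>': "sign_iso \<psi>' A" "\<psi>' u = w" "\<And>y. y \<notin> {l<..<h} \<Longrightarrow> \<psi>' y = \<psi> y"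
      using sign_iso_move[OF \<psi>(1) lh(1,2) w(1,2)] nz by metis
    \<comment> \<open>By Rolle, a gap of \<open>Z\<close> contains at most one root of
      \<open>P\<close>, so redirecting \<open>u\<close> disturbs none of the roots treated
      before.\<close>
    have "poly Q (\<psi>' x) = 0" if x: "x \<in> U" for x
    proof -
      have "x \<notin> {l<..<h}"
      proof
        assume xin: "x \<in> {l<..<h}"
        have "x \<noteq> u" "poly P x = 0" using x insert by (auto simp: W_def)
        moreover have False if ab: "a < b" "poly P a = 0" "poly P b = 0" "l < a" "b < h" for a b
        proof -
          obtain z where z: "a < z" "z < b" "poly P b - poly P a = (b - a) * poly (pderiv P) z"
            using poly_MVT[OF ab(1)] by blast
          then have "poly (pderiv P) z = 0" using ab by simp
          then show False using nz[OF der dP, of z] z(1,2) ab by linarith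
        qed
        ultimately show False using u xin lh
          by (metis greaterThanLessThan_iff linorder_neqE_linordered_idom)
      qed
      then show ?thesis using \<psi>' \<psi>(3) x by auto
    qed
    moreover have "\<forall>z\<in>Z. \<psi>' z = \<phi> z" using \<psi>'(3) \<psi>(2) lh(3) by (metis disjoint_iff)
    ultimately show ?case using \<psi>' w(3) by auto
  qed
  obtain \<psi> where \<psi>: "sign_iso \<psi> A" "\<And>z. z \<in> Z \<Longrightarrow> \<psi> z = \<phi> z" "\<And>u. u \<in> W \<Longrightarrow> poly Q (\<psi> u) = 0"
    using insertU[OF W subset_refl] by auto
  have "sgn (poly P y) = sgn (poly Q (\<psi> y))" for y
  proof (cases "y \<in> Z")
    case True then show ?thesis using Zeq \<psi>(2) by auto
  next
    case False
    obtain l h where lh: "l < y" "y < h" "{l<..<h} \<inter> Z = {}"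
        "sgn (poly P l) = sgn (poly Q (\<psi> l))" "sgn (poly P h) = sgn (poly Q (\<psi> h))"
      using bracket[OF \<psi>(1,2) False] by blast
    have nz: "poly (pderiv P) z \<noteq> 0" if "l < z" "z < h" for z
      using ZI[OF der dP, of z] that lh(3) by auto
    have "poly Q (\<psi> u) = 0" if "l < u" "u < h" "poly P u = 0" for u
    proof -
      have "u \<notin> Z" using that lh(3) by auto
      then show ?thesis using \<psi>(3)[of u] that by (auto simp: W_def)
    qed
    then show ?thesis
      using poly_crossing(2)[OF sign_isoD(1,2)[OF \<psi>(1)] sign_isoD(3)[OF \<psi>(1) der] nz lh(4,5,1,2)]
      by blast
  qed
  then have "sign_iso \<psi> (insert (P, Q) A)" using \<psi>(1) by (auto simp: sign_iso_def)
  then show ?thesis by blast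
qed

section \<open>The Tarski--Seidenberg theorem\<close>

text \<open>Performs a fixed number of division steps without asking whether
  \<open>coeff q m\<close> vanishes, so the result depends polynomially on the coefficients of
  \<open>p\<close> and \<open>q\<close>. At a root of \<open>q\<close> each step merely multiplies
  the value by \<open>coeff q m\<close>.\<close>

primrec pseudo_rem :: "nat \<Rightarrow> nat \<Rightarrow> real poly \<Rightarrow> real poly \<Rightarrow> real poly" where
  "pseudo_rem 0 m q p = p"
| "pseudo_rem (Suc k) m q p = pseudo_rem k m q (smult (coeff q m) p - monom (coeff p (m + k)) k * q)"

lemma poly_pseudo_rem:
  "poly q z = 0 \<Longrightarrow> poly (pseudo_rem k m q p) z = coeff q m ^ k * poly p z"
  by (induction k arbitrary: p) auto

text \<open>Every step cancels the highest coefficient that can be present. The escape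
  \<open>m = 0\<close> is there because the zero polynomial has degree 0.\<close>

lemma degree_pseudo_rem:
  assumes "degree q \<le> m" "degree p < m + k"
  shows "degree (pseudo_rem k m q p) < m \<or> m = 0"
  using assms(2)
proof (induction k arbitrary: p)
  case 0
  then show ?case by simp
next
  case (Suc k)
  let ?r = "smult (coeff q m) p - monom (coeff p (m + k)) k * q"
  show ?case
  proof (cases "m = 0")
    case False
    have "coeff ?r i = 0" if "i > m + k - 1" for i
    proof (cases "i = m + k")
      case True
      then show ?thesis by (simp add: coeff_monom_mult)
    next
      case F: False
      then have i: "i > m + k" using that False by linarith
      then have "coeff p i = 0" "coeff q (i - k) = 0"
        using Suc.prems assms(1) by (auto intro!: coeff_eq_0)
      then show ?thesis by (simp add: coeff_monom_mult)
    qed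
    then have "degree ?r \<le> m + k - 1" by (intro degree_le) auto
    then have "degree ?r < m + k" using False by linarith
    then show ?thesis using Suc.IH by simp
  qed simp
qed

section \<open>Polynomials in one variable with coefficients depending on parameters\<close>

lemma real_polynomial_function_coeff_mult:
  assumes "\<And>i. real_polynomial_function (\<lambda>x. coeff (p x) i)"
    and "\<And>i. real_polynomial_function (\<lambda>x. coeff (q x) i)"
  shows "real_polynomial_function (\<lambda>x. coeff (p x * q x) i)"
  unfolding coeff_mult using assms by (intro real_polynomial_function_sum) auto

lemma real_polynomial_function_coeff_pCons:
  assumes "real_polynomial_function a" "\<And>i. real_polynomial_function (\<lambda>x. coeff (p x) i)"
  shows "real_polynomial_function (\<lambda>x. coeff (pCons (a x) (p x)) i)"
  using assms by (cases i) auto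

lemma real_polynomial_function_pseudo_rem:
  assumes "\<And>i. real_polynomial_function (\<lambda>x. coeff (q x) i)"
    and "\<And>i. real_polynomial_function (\<lambda>x. coeff (p x) i)"
  shows "real_polynomial_function (\<lambda>x. coeff (pseudo_rem k m (q x) (p x)) i)"
  using assms(2)
proof (induction k arbitrary: p)
  case (Suc k)
  have "real_polynomial_function
     (\<lambda>x. coeff (smult (coeff (q x) m) (p x) - monom (coeff (p x) (m + k)) k * q x) i)" for i
    using assms(1) Suc.prems
    by (cases "i < k") (auto simp: coeff_monom_mult intro!: real_polynomial_function_diff)
  then show ?case by (simp add: Suc.IH)
qed simp

text \<open>The first component is a formal degree: the actual degree drops wherever the leading
  coefficient vanishes, so induction and division run on a bound that is independent of
  \<open>x\<close>.\<close>

definition poly_family :: "nat \<times> ('a::real_normed_vector \<Rightarrow> real poly) \<Rightarrow> bool" where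
  "poly_family p \<longleftrightarrow> (\<forall>x. degree (snd p x) \<le> fst p) \<and>
     (\<forall>i. real_polynomial_function (\<lambda>x. coeff (snd p x) i))"

definition fam_deriv :: "nat \<times> ('a \<Rightarrow> real poly) \<Rightarrow> nat \<times> ('a \<Rightarrow> real poly)" where
  "fam_deriv p = (fst p - 1, \<lambda>x. pderiv (snd p x))"

definition fam_trunc :: "nat \<times> ('a \<Rightarrow> real poly) \<Rightarrow> nat \<times> ('a \<Rightarrow> real poly)" where
  "fam_trunc p = (fst p - 1, \<lambda>x. snd p x - monom (coeff (snd p x) (fst p)) (fst p))"

definition fam_lead :: "nat \<times> ('a \<Rightarrow> real poly) \<Rightarrow> nat \<times> ('a \<Rightarrow> real poly)" where
  "fam_lead p = (0, \<lambda>x. [:coeff (snd p x) (fst p):])"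

text \<open>One division step for each degree from \<open>fst q\<close> to \<open>fst p\<close>
  inclusive, hence the \<open>Suc\<close>.\<close>

definition fam_rem :: "nat \<times> ('a \<Rightarrow> real poly) \<Rightarrow> nat \<times> ('a \<Rightarrow> real poly) \<Rightarrow> nat \<times> ('a \<Rightarrow> real poly)" where
  "fam_rem p q = (fst q - 1, \<lambda>x. pseudo_rem (Suc (fst p) - fst q) (fst q) (snd q x) (snd p x))"

lemma poly_family_ops:
  assumes p: "poly_family p" and n: "0 < fst p"
  shows "poly_family (fam_deriv p)" "poly_family (fam_trunc p)" "poly_family (fam_lead p)"
    and "poly_family q \<Longrightarrow> 0 < fst q \<Longrightarrow> fst q \<le> fst p \<Longrightarrow> poly_family (fam_rem p q)"
proof -
  have deg: "degree (snd p x) \<le> fst p" and pf: "real_polynomial_function (\<lambda>x. coeff (snd p x) i)" for x i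
    using p by (auto simp: poly_family_def)
  show "poly_family (fam_deriv p)"
    using deg pf by (auto simp: poly_family_def fam_deriv_def degree_pderiv coeff_pderiv intro!: diff_le_mono)
  have "degree (snd p x - monom (coeff (snd p x) (fst p)) (fst p)) \<le> fst p - 1" for x
  proof (rule degree_le, intro allI impI)
    fix i assume "fst p - 1 < i"
    then have "i = fst p \<or> i > fst p" using n by linarith
    then show "coeff (snd p x - monom (coeff (snd p x) (fst p)) (fst p)) i = 0"
      using deg[of x] by (auto simp: coeff_eq_0)
  qed
  moreover have "real_polynomial_function (\<lambda>x. coeff (snd p x - monom (coeff (snd p x) (fst p)) (fst p)) i)" for i
    using pf by (cases "fst p = i") auto
  ultimately show "poly_family (fam_trunc p)"
    by (simp add: poly_family_def fam_trunc_def)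
  show "poly_family (fam_lead p)"
    using pf real_polynomial_function_coeff_pCons[where p="\<lambda>_. 0"]
    by (auto simp: poly_family_def fam_lead_def)
  assume q: "poly_family q" "0 < fst q" "fst q \<le> fst p"
  have "degree (snd q x) \<le> fst q" "degree (snd p x) < fst q + (Suc (fst p) - fst q)" for x
    using q deg[of x] by (auto simp: poly_family_def)
  then have "degree (pseudo_rem (Suc (fst p) - fst q) (fst q) (snd q x) (snd p x)) \<le> fst q - 1" for x
    using degree_pseudo_rem[of "snd q x" "fst q" "snd p x" "Suc (fst p) - fst q"] q(2) by force
  then show "poly_family (fam_rem p q)"
    using pf q(1) by (auto simp: poly_family_def fam_rem_def intro!: real_polynomial_function_pseudo_rem)
qed

text \<open>The threshold \<open>m\<close> records how far down the closing has progressed.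
  Constants are exempt, since their formal degree cannot drop further.\<close>

definition closed_above :: "nat \<Rightarrow> (nat \<times> ('a \<Rightarrow> real poly)) set \<Rightarrow> bool" where
  "closed_above m C \<longleftrightarrow>
     (\<forall>q\<in>C. 0 < fst q \<and> m \<le> fst q \<longrightarrow>
        fam_deriv q \<in> C \<and> fam_trunc q \<in> C \<and> fam_lead q \<in> C \<and>
        (\<forall>p\<in>C. fst q \<le> fst p \<longrightarrow> fam_rem p q \<in> C))"

text \<open>Every operation on a family of formal degree \<open>k\<close> produces one of smaller formal degree, so
  closing off the degrees from the top downwards terminates.\<close>

lemma ex_closed_above:
  fixes F :: "(nat \<times> ('a::real_normed_vector \<Rightarrow> real poly)) set"
  assumes F: "finite F" "\<And>p. p \<in> F \<Longrightarrow> poly_family p"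
  shows "\<exists>C. finite C \<and> F \<subseteq> C \<and> (\<forall>p\<in>C. poly_family p) \<and> closed_above 0 C"
proof -
  obtain D where D: "\<And>p. p \<in> F \<Longrightarrow> fst p \<le> D"
    using finite_nat_set_iff_bounded_le[of "fst ` F"] F(1) by auto
  have "\<exists>C. finite C \<and> F \<subseteq> C \<and> (\<forall>p\<in>C. poly_family p \<and> fst p \<le> D) \<and> closed_above (Suc D - j) C" for j
  proof (induction j)
    case 0
    show ?case using F D by (intro exI[of _ F]) (fastforce simp: closed_above_def)
  next
    case (Suc j)
    then obtain C where C: "finite C" "F \<subseteq> C" "\<And>p. p \<in> C \<Longrightarrow> poly_family p" "\<And>p. p \<in> C \<Longrightarrow> fst p \<le> D"
      "closed_above (Suc D - j) C" by blast
    define k where "k = Suc D - Suc j"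
    define S where "S = {q \<in> C. fst q = k \<and> 0 < k}"
    define N where "N = fam_deriv ` S \<union> fam_trunc ` S \<union> fam_lead ` S \<union>
      (\<lambda>(p, q). fam_rem p q) ` {(p, q). p \<in> C \<and> q \<in> S \<and> k \<le> fst p}"
    have "{(p, q). p \<in> C \<and> q \<in> S \<and> k \<le> fst p} \<subseteq> C \<times> C" by (auto simp: S_def)
    then have fin: "finite N"
      using C(1) finite_subset[OF _ finite_cartesian_product[OF C(1) C(1)]] by (auto simp: N_def S_def)
    have N: "poly_family p \<and> fst p < k" if pN: "p \<in> N" for p
    proof -
      have S: "poly_family q" "fst q = k" "0 < fst q" if "q \<in> S" for q
        using that C(3) by (auto simp: S_def)
      have "(\<exists>q\<in>S. p = fam_deriv q) \<or> (\<exists>q\<in>S. p = fam_trunc q) \<or> (\<exists>q\<in>S. p = fam_lead q) \<or>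
          (\<exists>r\<in>C. \<exists>q\<in>S. k \<le> fst r \<and> p = fam_rem r q)"
        using pN unfolding N_def by fastforce
      then consider q where "q \<in> S" "p = fam_deriv q" | q where "q \<in> S" "p = fam_trunc q"
        | q where "q \<in> S" "p = fam_lead q" | r q where "r \<in> C" "q \<in> S" "k \<le> fst r" "p = fam_rem r q"
        by blast
      then show ?thesis
      proof cases
        case 1
        show ?thesis using poly_family_ops(1)[OF S(1,3)[OF 1(1)]] S(2,3)[OF 1(1)] 1(2) by (simp add: fam_deriv_def)
      next
        case 2
        show ?thesis using poly_family_ops(2)[OF S(1,3)[OF 2(1)]] S(2,3)[OF 2(1)] 2(2) by (simp add: fam_trunc_def)
      next
        case 3
        show ?thesis using poly_family_ops(3)[OF S(1,3)[OF 3(1)]] S(2,3)[OF 3(1)] 3(2) by (simp add: fam_lead_def)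
      next
        case 4
        have "fst q \<le> fst r" "0 < fst r" using 4(3) S(2,3)[OF 4(2)] by auto
        then show ?thesis
          using poly_family_ops(4)[OF C(3)[OF 4(1)] _ S(1,3)[OF 4(2)]] S(2,3)[OF 4(2)] 4(4) by (simp add: fam_rem_def)
      qed
    qed
    have kD: "k \<le> D" by (simp add: k_def)
    have "closed_above k (C \<union> N)"
      unfolding closed_above_def
    proof (intro ballI impI)
      fix q assume q: "q \<in> C \<union> N" "0 < fst q \<and> k \<le> fst q"
      \<comment> \<open>Members of \<open>N\<close> have formal degree below \<open>k\<close>, so
        they occur here neither as divisors nor as dividends, and the degrees closed before stay
        closed.\<close>
      then have qC: "q \<in> C" using N[of q] by (metis Un_iff not_le)
      have pC: "p \<in> C" if "p \<in> C \<union> N" "fst q \<le> fst p" for p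
        using that N[of p] q by (metis Un_iff not_le order_trans)
      show "fam_deriv q \<in> C \<union> N \<and> fam_trunc q \<in> C \<union> N \<and> fam_lead q \<in> C \<union> N \<and>
        (\<forall>p\<in>C \<union> N. fst q \<le> fst p \<longrightarrow> fam_rem p q \<in> C \<union> N)"
      proof (cases "fst q = k")
        case True
        then have "q \<in> S" using qC q by (auto simp: S_def)
        have "fam_rem p q \<in> N" if "p \<in> C \<union> N" "fst q \<le> fst p" for p
        proof -
          have "(p, q) \<in> {(p, q). p \<in> C \<and> q \<in> S \<and> k \<le> fst p}"
            using pC[OF that] \<open>q \<in> S\<close> that(2) True by simp
          from imageI[OF this, of "\<lambda>(p, q). fam_rem p q"] show ?thesis by (simp add: N_def)
        qed
        moreover have "fam_deriv q \<in> N" "fam_trunc q \<in> N" "fam_lead q \<in> N"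
          using \<open>q \<in> S\<close> by (auto simp: N_def)
        ultimately show ?thesis by blast
      next
        case False
        then have "Suc D - j \<le> fst q" using q by (auto simp: k_def)
        then have "fam_deriv q \<in> C \<and> fam_trunc q \<in> C \<and> fam_lead q \<in> C \<and>
           (\<forall>p\<in>C. fst q \<le> fst p \<longrightarrow> fam_rem p q \<in> C)"
          using C(5) qC q unfolding closed_above_def by blast
        then show ?thesis using pC by blast
      qed
    qed
    moreover have "\<forall>p\<in>C \<union> N. poly_family p \<and> fst p \<le> D" using C(3,4) N kD by fastforce
    ultimately show ?case using fin C(1,2) unfolding k_def by (intro exI[of _ "C \<union> N"]) auto
  qed
  from this[of "Suc D"] show ?thesis by auto
qed

text \<open>A leading coefficient that vanishes at \<open>x\<close> vanishes at \<open>x'\<close>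
  too, by the sign condition on \<open>fam_lead\<close>, so truncation changes neither polynomial
  and lowers the formal degree. With a vanishing leading coefficient the divisor would yield a
  remainder without information.\<close>

lemma closed_family_nonzero_lead:
  assumes cl: "closed_above 0 C" and fam: "\<And>p. p \<in> C \<Longrightarrow> poly_family p"
    and lead: "\<And>q. q \<in> C \<Longrightarrow> fst q = 0 \<Longrightarrow> sgn (coeff (snd q x) 0) = sgn (coeff (snd q x') 0)"
    and "q \<in> C" "snd q x \<noteq> 0"
  shows "\<exists>q'\<in>C. fst q' \<le> fst q \<and> snd q' x = snd q x \<and> snd q' x' = snd q x' \<and> coeff (snd q' x) (fst q') \<noteq> 0"
  using assms(4,5)
proof (induction "fst q" arbitrary: q rule: less_induct)
  case less
  show ?case
  proof (cases "coeff (snd q x) (fst q) = 0")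
    case True
    have deg: "degree (snd q x) \<le> fst q" using fam less.prems by (auto simp: poly_family_def)
    have pos: "0 < fst q"
    proof (rule ccontr)
      assume "\<not> 0 < fst q"
      then have "degree (snd q x) = 0" "fst q = 0" using deg by auto
      then show False using True less.prems(2) by (metis leading_coeff_0_iff)
    qed
    have mem: "fam_trunc q \<in> C" "fam_lead q \<in> C"
      using cl less.prems(1) pos by (auto simp: closed_above_def)
    have "coeff (snd q x') (fst q) = 0"
      using lead[OF mem(2)] True by (simp add: fam_lead_def sgn_zero_iff)
    then have same: "snd (fam_trunc q) x = snd q x" "snd (fam_trunc q) x' = snd q x'"
      using True by (auto simp: fam_trunc_def)
    have lt: "fst (fam_trunc q) < fst q" using pos by (simp add: fam_trunc_def)
    have "snd (fam_trunc q) x \<noteq> 0" using less.prems(2) same by simp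
    from less.hyps[OF lt mem(1) this] obtain q' where "q' \<in> C" "fst q' \<le> fst (fam_trunc q)"
       "snd q' x = snd q x" "snd q' x' = snd q x'" "coeff (snd q' x) (fst q') \<noteq> 0"
      unfolding same by blast
    then show ?thesis using lt by (intro bexI[of _ q']) auto
  qed (use less.prems in auto)
qed

lemma closed_family_sign_iso:
  assumes fin: "finite C" and cl: "closed_above 0 C" and fam: "\<And>p. p \<in> C \<Longrightarrow> poly_family p"
    and lead: "\<And>q. q \<in> C \<Longrightarrow> fst q = 0 \<Longrightarrow> sgn (coeff (snd q x) 0) = sgn (coeff (snd q x') 0)"
  shows "\<exists>\<phi>. sign_iso \<phi> ((\<lambda>p. (snd p x, snd p x')) ` {p \<in> C. fst p \<le> d})"
proof (induction d)
  case 0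
  have "sgn (poly (snd p x) y) = sgn (poly (snd p x') y)" if "p \<in> C" "fst p = 0" for p y
  proof -
    have "degree (snd p x) = 0" "degree (snd p x') = 0"
      using fam[OF that(1)] that(2) by (auto simp: poly_family_def)
    then show ?thesis using lead[OF that] by (auto elim!: degree_eq_zeroE)
  qed
  then show ?case by (intro exI[of _ id]) (auto simp: sign_iso_def strict_mono_def)
next
  case (Suc d)
  let ?pr = "\<lambda>p. (snd p x, snd p x')"
  let ?A = "{p \<in> C. fst p \<le> d}"
  have "\<exists>\<phi>. sign_iso \<phi> (?pr ` (?A \<union> U))" if "finite U" "U \<subseteq> {p \<in> C. fst p = Suc d}" for U
    using that
  proof (induction U rule: finite_induct)
    case empty
    then show ?case using Suc.IH by simp
  next
    case (insert p U)
    then obtain \<phi> where \<phi>: "sign_iso \<phi> (?pr ` (?A \<union> U))" by auto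
    have p: "p \<in> C" "fst p = Suc d" using insert by auto
    have mem: "fam_deriv p \<in> C" "fam_trunc p \<in> C" "fam_lead p \<in> C"
      using cl p by (auto simp: closed_above_def)
    have lc: "sgn (coeff (snd p x) (Suc d)) = sgn (coeff (snd p x') (Suc d))"
      using lead[OF mem(3)] p by (simp add: fam_lead_def)
    show ?case
    proof (cases "coeff (snd p x) (Suc d) = 0")
      \<comment> \<open>At both parameters \<open>p\<close> coincides with its truncation, whose
        signs are matched already.\<close>
      case True
      then have "coeff (snd p x') (Suc d) = 0" using lc by (simp add: sgn_zero_iff)
      then have "?pr p = ?pr (fam_trunc p)" using True p by (simp add: fam_trunc_def)
      moreover have "fam_trunc p \<in> ?A" using mem p by (simp add: fam_trunc_def)
      ultimately have "?pr ` (?A \<union> insert p U) = ?pr ` (?A \<union> U)" by (auto simp: image_iff)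
      then show ?thesis using \<phi> by metis
    next
      case False
      then have F': "coeff (snd p x') (Suc d) \<noteq> 0" using lc by (metis sgn_zero_iff)
      have "degree (snd p x) \<le> Suc d" "degree (snd p x') \<le> Suc d"
        using fam p by (metis poly_family_def)+
      then have deg: "degree (snd p x) = Suc d" "degree (snd p x') = Suc d"
        using False F' by (metis le_antisym le_degree)+
      have der: "(pderiv (snd p x), pderiv (snd p x')) \<in> ?pr ` (?A \<union> U)"
        using mem p by (force simp: fam_deriv_def intro!: image_eqI[of _ _ "fam_deriv p"])
      \<comment> \<open>At a root of \<open>S\<close> the remainder of \<open>p\<close> takes the
        value of \<open>p\<close> times a power of the leading coefficient of \<open>S\<close>. The
        divisor may have formal degree \<open>Suc d\<close> itself; the remainder still has formal
        degree at most \<open>d\<close> and is matched by \<phi>.\<close>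
      have rem: "sgn (poly (snd p x) z) = sgn (poly (snd p x') (\<phi> z))"
        if ST: "(S, T) \<in> ?pr ` (?A \<union> U)" and S0: "S \<noteq> 0" and z: "poly S z = 0" for S T z
      proof -
        from ST obtain q0 where q0: "q0 \<in> C" "fst q0 \<le> Suc d" "S = snd q0 x" "T = snd q0 x'"
          using insert by auto
        obtain q where q: "q \<in> C" "fst q \<le> Suc d" "S = snd q x" "T = snd q x'" "coeff S (fst q) \<noteq> 0"
          using closed_family_nonzero_lead[OF cl fam lead q0(1)] q0 S0 by force
        have pos: "0 < fst q"
        proof (rule ccontr)
          assume *: "\<not> 0 < fst q"
          then have "degree S = 0" using fam[OF q(1)] q(3) by (simp add: poly_family_def)
          then show False using q(5) z * by (auto elim!: degree_eq_zeroE)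
        qed
        have "poly T (\<phi> z) = 0" using sign_isoD(3)[OF \<phi> ST, of z] z by (simp add: sgn_zero_iff)
        have "fam_lead q \<in> C" "fam_rem p q \<in> C"
          using cl q(1,2) p pos by (auto simp: closed_above_def)
        moreover have "fst (fam_rem p q) \<le> d" using pos q(2) by (simp add: fam_rem_def)
        ultimately have lcq: "sgn (coeff S (fst q)) = sgn (coeff T (fst q))"
          and R: "?pr (fam_rem p q) \<in> ?pr ` (?A \<union> U)"
          using lead[of "fam_lead q"] q by (auto simp: fam_lead_def)
        define k where "k = Suc (fst p) - fst q"
        have "sgn (poly (snd (fam_rem p q) x) z) = sgn (poly (snd (fam_rem p q) x') (\<phi> z))"
          using sign_isoD(3)[OF \<phi> R] .
        then have "sgn (coeff S (fst q) ^ k * poly (snd p x) z) = sgn (coeff T (fst q) ^ k * poly (snd p x') (\<phi> z))"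
          using z \<open>poly T (\<phi> z) = 0\<close> q(3,4) by (simp add: fam_rem_def poly_pseudo_rem k_def)
        moreover have "sgn (coeff S (fst q) ^ k) = sgn (coeff T (fst q) ^ k)"
          using lcq by (induction k) (simp_all add: sgn_mult)
        moreover have "sgn (coeff S (fst q) ^ k) \<noteq> 0" using q(5) by (simp add: sgn_zero_iff)
        ultimately show ?thesis by (metis sgn_mult mult_left_cancel)
      qed
      have finA: "finite (?pr ` (?A \<union> U))" using fin insert by auto
      have "\<exists>\<psi>. sign_iso \<psi> (insert (snd p x, snd p x') (?pr ` (?A \<union> U)))"
        using sign_iso_insert[OF finA \<phi> _ _ _ der rem] deg lc by auto
      then show ?thesis by simp
    qed
  qed
  from this[of "{p \<in> C. fst p = Suc d}"] fin
  have "\<exists>\<phi>. sign_iso \<phi> (?pr ` (?A \<union> {p \<in> C. fst p = Suc d}))" by auto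
  moreover have "?A \<union> {p \<in> C. fst p = Suc d} = {p \<in> C. fst p \<le> Suc d}" by auto
  ultimately show ?case by simp
qed

section \<open>Elimination of one real variable\<close>

lemma real_polynomial_function_as_family:
  fixes p :: "'a::real_normed_vector \<times> real \<Rightarrow> real"
  assumes "real_polynomial_function p"
  shows "\<exists>c. poly_family c \<and> (\<forall>x y. p (x, y) = poly (snd c x) y)"
  using assms
proof (induction p rule: real_polynomial_function.induct)
  case (linear f)
  have split: "f (x, y) = f (x, 0) + y * f (0, 1)" for x y
  proof -
    have "f (x, y) = f ((x, 0) + y *\<^sub>R (0, 1))" by simp
    also have "\<dots> = f (x, 0) + y * f (0, 1)"
      using linear by (simp only: linear_add linear_scale bounded_linear.linear real_scaleR_def)
    finally show ?thesis .
  qed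
  have poly_eq: "f (x, y) = poly [:f (x, 0), f (0, 1):] y" for x y
    by (subst split) simp
  have "bounded_linear (\<lambda>x. f (x, 0))"
    using bounded_linear_compose[OF linear bounded_linear_Pair[OF bounded_linear_ident bounded_linear_zero]] .
  then have "real_polynomial_function (\<lambda>x. f (x, 0))" by blast
  show ?case
  proof (intro exI[of _ "(1, \<lambda>x. [:f (x, 0), f (0, 1):])"] conjI allI)
    have "real_polynomial_function (\<lambda>x. coeff [:f (x, 0), f (0, 1):] i)" for i
      by (rule real_polynomial_function_coeff_pCons) (fact, rule real_polynomial_function.intros(2))
    then show "poly_family (1, \<lambda>x. [:f (x, 0), f (0, 1):])"
      by (simp add: poly_family_def)
    show "f (x, y) = poly (snd (1, \<lambda>x. [:f (x, 0), f (0, 1):]) x) y" for x y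
      unfolding snd_conv by (rule poly_eq)
  qed
next
  case (const c)
  then show ?case
    by (intro exI[of _ "(0, \<lambda>x. [:c:])"]) (simp add: poly_family_def real_polynomial_function.intros(2))
next
  case (add f g)
  then obtain c d where "poly_family c" "\<And>x y. f (x, y) = poly (snd c x) y"
    "poly_family d" "\<And>x y. g (x, y) = poly (snd d x) y" by blast
  then show ?case
    by (intro exI[of _ "(max (fst c) (fst d), \<lambda>x. snd c x + snd d x)"])
       (simp add: poly_family_def real_polynomial_function.intros(3) degree_add_le max.coboundedI1 max.coboundedI2)
next
  case (mult f g)
  then obtain c d where "poly_family c" "\<And>x y. f (x, y) = poly (snd c x) y"
    "poly_family d" "\<And>x y. g (x, y) = poly (snd d x) y" by blast
  then show ?case
    by (intro exI[of _ "(fst c + fst d, \<lambda>x. snd c x * snd d x)"])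
       (simp add: poly_family_def real_polynomial_function_coeff_mult
          order_trans[OF degree_mult_le add_mono])
qed

text \<open>A predicate is semialgebraic when finitely many polynomial signs decide it; no normal form
  is ever needed.\<close>

definition sa :: "('a::real_normed_vector \<Rightarrow> bool) \<Rightarrow> bool" where
  "sa P \<longleftrightarrow> (\<exists>F. finite F \<and> (\<forall>p\<in>F. real_polynomial_function p) \<and>
     (\<forall>x y. (\<forall>p\<in>F. sgn (p x) = sgn (p y)) \<longrightarrow> P x = P y))"

lemma sa_cells:
  fixes P :: "'a::real_normed_vector \<times> real \<Rightarrow> bool"
  assumes "sa P"
  obtains C where "finite C" "closed_above 0 C" "\<And>p. p \<in> C \<Longrightarrow> poly_family p"
    "\<And>x y x' y'. (\<And>p. p \<in> C \<Longrightarrow> sgn (poly (snd p x) y) = sgn (poly (snd p x') y')) \<Longrightarrow> P (x, y) = P (x', y')"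
proof -
  obtain F where F: "finite F" "\<And>p. p \<in> F \<Longrightarrow> real_polynomial_function p"
    and FP: "\<forall>z w. (\<forall>p\<in>F. sgn (p z) = sgn (p w)) \<longrightarrow> P z = P w"
    using assms unfolding sa_def by auto
  define c where "c p = (SOME c. poly_family c \<and> (\<forall>x y. p (x, y) = poly (snd c x) y))" for p :: "'a \<times> real \<Rightarrow> real"
  have "poly_family (c p) \<and> (\<forall>x y. p (x, y) = poly (snd (c p) x) y)" if "p \<in> F" for p
    unfolding c_def using real_polynomial_function_as_family[OF F(2)[OF that]] by (rule someI_ex)
  then have c: "poly_family (c p)" "p (x, y) = poly (snd (c p) x) y" if "p \<in> F" for p x y
    using that by blast+
  have "finite (c ` F)" "\<And>q. q \<in> c ` F \<Longrightarrow> poly_family q" using F(1) c(1) by blast+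
  from ex_closed_above[OF this] obtain C where
    C: "finite C" "c ` F \<subseteq> C" "\<And>p. p \<in> C \<Longrightarrow> poly_family p" "closed_above 0 C"
    by blast
  show ?thesis
  proof (rule that[OF C(1,4,3)])
    fix x y x' y'
    assume *: "\<And>p. p \<in> C \<Longrightarrow> sgn (poly (snd p x) y) = sgn (poly (snd p x') y')"
    show "P (x, y) = P (x', y')"
    proof (rule FP[rule_format])
      fix p assume p: "p \<in> F"
      then have "c p \<in> C" using C(2) by blast
      from *[OF this] show "sgn (p (x, y)) = sgn (p (x', y'))" by (simp add: c(2)[OF p])
    qed
  qed
qed

text \<open>The constants of the closed family decide the projection: if their signs agree at
  \<open>x\<close> and \<open>x'\<close>, the order isomorphism carries each witness over
  \<open>x\<close> to a witness over \<open>x'\<close>. No root is counted and no formula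
  computed.\<close>

theorem sa_ex_real:
  fixes P :: "'a::real_normed_vector \<times> real \<Rightarrow> bool"
  assumes "sa P"
  shows "sa (\<lambda>x. \<exists>y. P (x, y))"
proof -
  obtain C where C: "finite C" "closed_above 0 C" "\<And>p. p \<in> C \<Longrightarrow> poly_family p"
    "\<And>x y x' y'. (\<And>p. p \<in> C \<Longrightarrow> sgn (poly (snd p x) y) = sgn (poly (snd p x') y')) \<Longrightarrow> P (x, y) = P (x', y')"
    using sa_cells[OF assms] by metis
  define G where "G = (\<lambda>p x. coeff (snd p x) 0) ` {p \<in> C. fst p = 0}"
  obtain d where d: "\<And>p. p \<in> C \<Longrightarrow> fst p \<le> d"
    using finite_nat_set_iff_bounded_le[of "fst ` C"] C(1) by auto
  have "(\<exists>y. P (x, y)) \<longrightarrow> (\<exists>y. P (x', y))" if "\<forall>g\<in>G. sgn (g x) = sgn (g x')" for x x'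
  proof -
    have "sgn (coeff (snd q x) 0) = sgn (coeff (snd q x') 0)" if "q \<in> C" "fst q = 0" for q
    proof -
      have "(\<lambda>x. coeff (snd q x) 0) \<in> G" using that by (auto simp: G_def)
      from bspec[OF \<open>\<forall>g\<in>G. _\<close> this] show ?thesis .
    qed
    then obtain \<phi> where \<phi>: "sign_iso \<phi> ((\<lambda>p. (snd p x, snd p x')) ` {p \<in> C. fst p \<le> d})"
      using closed_family_sign_iso[OF C(1-3)] by blast
    have "sgn (poly (snd p x) y) = sgn (poly (snd p x') (\<phi> y))" if "p \<in> C" for p y
      by (rule sign_isoD(3)[OF \<phi>]) (use that d in auto)
    then have "P (x, y) = P (x', \<phi> y)" for y by (rule C(4))
    then show ?thesis by blast
  qed
  then have "\<forall>x y. (\<forall>g\<in>G. sgn (g x) = sgn (g y)) \<longrightarrow> (\<exists>z. P (x, z)) = (\<exists>z. P (y, z))"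
    by metis
  moreover have "finite G" "\<forall>g\<in>G. real_polynomial_function g"
    using C(1,3) by (auto simp: G_def poly_family_def)
  ultimately show ?thesis unfolding sa_def by blast
qed

section \<open>Semialgebraic predicates and functions\<close>

lemma sa_not: "sa P \<Longrightarrow> sa (\<lambda>x. \<not> P x)"
  unfolding sa_def by blast

lemma sa_const: "sa (\<lambda>x. c)"
  unfolding sa_def by (intro exI[of _ "{}"]) auto

lemma sa_conj:
  assumes "sa P" "sa Q"
  shows "sa (\<lambda>x. P x \<and> Q x)"
proof -
  obtain F G where "finite F" "\<forall>p\<in>F. real_polynomial_function p"
    "\<forall>x y. (\<forall>p\<in>F. sgn (p x) = sgn (p y)) \<longrightarrow> P x = P y"
    "finite G" "\<forall>p\<in>G. real_polynomial_function p"
    "\<forall>x y. (\<forall>p\<in>G. sgn (p x) = sgn (p y)) \<longrightarrow> Q x = Q y"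
    using assms unfolding sa_def by auto
  then show ?thesis unfolding sa_def by (intro exI[of _ "F \<union> G"]) (simp add: ball_Un, blast)
qed

lemma sa_disj:
  assumes "sa P" "sa Q"
  shows "sa (\<lambda>x. P x \<or> Q x)"
proof -
  have "sa (\<lambda>x. \<not> (\<not> P x \<and> \<not> Q x))" by (rule sa_not sa_conj assms)+
  then show ?thesis by simp
qed

lemma sa_imp:
  assumes "sa P" "sa Q"
  shows "sa (\<lambda>x. P x \<longrightarrow> Q x)"
proof -
  have "sa (\<lambda>x. \<not> P x \<or> Q x)" by (rule sa_disj sa_not assms)+
  then show ?thesis by simp
qed

lemma sa_Ball: "finite A \<Longrightarrow> (\<And>a. a \<in> A \<Longrightarrow> sa (P a)) \<Longrightarrow> sa (\<lambda>x. \<forall>a\<in>A. P a x)"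
proof (induction A rule: finite_induct)
  case (insert a A)
  then have "sa (\<lambda>x. P a x \<and> (\<forall>a\<in>A. P a x))"
    by (intro sa_conj) auto
  then show ?case by simp
qed (simp add: sa_const)

lemma sa_Bex: "finite A \<Longrightarrow> (\<And>a. a \<in> A \<Longrightarrow> sa (P a)) \<Longrightarrow> sa (\<lambda>x. \<exists>a\<in>A. P a x)"
proof (induction A rule: finite_induct)
  case (insert a A)
  then have "sa (\<lambda>x. P a x \<or> (\<exists>a\<in>A. P a x))"
    by (intro sa_disj) auto
  then show ?case by simp
qed (simp add: sa_const)

lemma sa_poly_sign:
  assumes "real_polynomial_function p"
  shows "sa (\<lambda>x. p x > 0)" "sa (\<lambda>x. p x \<ge> 0)" "sa (\<lambda>x. p x = 0)"
proof -
  have "sa (\<lambda>x. Q (sgn (p x)))" for Q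
    unfolding sa_def using assms by (intro exI[of _ "{p}"]) simp
  from this[of "\<lambda>s. s > 0"] this[of "\<lambda>s. s \<ge> 0"] this[of "\<lambda>s. s = 0"]
  show "sa (\<lambda>x. p x > 0)" "sa (\<lambda>x. p x \<ge> 0)" "sa (\<lambda>x. p x = 0)"
    by (simp_all add: sgn_zero_iff)
qed

lemma sa_polynomial_subst:
  assumes "sa P" "polynomial_function g"
  shows "sa (\<lambda>x. P (g x))"
proof -
  obtain F where F: "finite F" "\<forall>p\<in>F. real_polynomial_function p"
    "\<forall>x y. (\<forall>p\<in>F. sgn (p x) = sgn (p y)) \<longrightarrow> P x = P y"
    using assms(1) unfolding sa_def by auto
  show ?thesis
    unfolding sa_def
  proof (intro exI[of _ "(\<lambda>p. p \<circ> g) ` F"] conjI)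
    show "\<forall>p\<in>(\<lambda>p. p \<circ> g) ` F. real_polynomial_function p"
      using F(2) assms(2) by (auto intro: real_polynomial_function_compose)
  qed (use F in simp_all)
qed

lemma sa_ex:
  fixes P :: "'a::real_normed_vector \<times> 'b::euclidean_space \<Rightarrow> bool"
  assumes "sa P"
  shows "sa (\<lambda>x. \<exists>y. P (x, y))"
proof -
  \<comment> \<open>Only the coordinates in \<open>B\<close> are eliminated; the summand
    \<open>snd z\<close> keeps the others as parameters and is set to 0 once \<open>B\<close> is the
    whole basis.\<close>
  have "sa (\<lambda>z. \<exists>c. P (fst z, snd z + (\<Sum>b\<in>B. c b *\<^sub>R b)))" if "finite B" for B :: "'b set"
    using that
  proof (induction B rule: finite_induct)
    case empty
    then show ?case using assms by simp
  next
    case (insert b B)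
    have bl: "bounded_linear (\<lambda>w::('a \<times> 'b) \<times> real. (fst (fst w), snd (fst w) + snd w *\<^sub>R b))"
      by (intro bounded_linear_intros)
    have "sa (\<lambda>w. \<exists>c. P (fst (fst w), (snd (fst w) + snd w *\<^sub>R b) + (\<Sum>b\<in>B. c b *\<^sub>R b)))"
      using sa_polynomial_subst[OF insert.IH polynomial_function_bounded_linear[OF bl]] by simp
    from sa_ex_real[OF this]
    have "sa (\<lambda>z. \<exists>t c. P (fst z, (snd z + t *\<^sub>R b) + (\<Sum>b\<in>B. c b *\<^sub>R b)))" by simp
    moreover have "(\<exists>t c. P (fst z, (snd z + t *\<^sub>R b) + (\<Sum>b\<in>B. c b *\<^sub>R b))) =
        (\<exists>c. P (fst z, snd z + (\<Sum>b\<in>insert b B. c b *\<^sub>R b)))" for z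
    proof
      assume "\<exists>t c. P (fst z, (snd z + t *\<^sub>R b) + (\<Sum>b\<in>B. c b *\<^sub>R b))"
      then obtain t c where *: "P (fst z, (snd z + t *\<^sub>R b) + (\<Sum>b\<in>B. c b *\<^sub>R b))" by blast
      have "(\<Sum>x\<in>B. (c(b := t)) x *\<^sub>R x) = (\<Sum>x\<in>B. c x *\<^sub>R x)"
        using insert.hyps(2) by (intro sum.cong) auto
      then show "\<exists>c. P (fst z, snd z + (\<Sum>b\<in>insert b B. c b *\<^sub>R b))"
        using * insert.hyps by (intro exI[of _ "c(b := t)"]) (simp add: add.assoc)
    next
      assume "\<exists>c. P (fst z, snd z + (\<Sum>b\<in>insert b B. c b *\<^sub>R b))"
      then show "\<exists>t c. P (fst z, (snd z + t *\<^sub>R b) + (\<Sum>b\<in>B. c b *\<^sub>R b))"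
        using insert.hyps by (auto simp: add.assoc)
    qed
    ultimately show ?case by simp
  qed
  from this[OF finite_Basis]
  have *: "sa (\<lambda>z. \<exists>c. P (fst z, snd z + (\<Sum>b\<in>Basis. c b *\<^sub>R b)))" .
  have "polynomial_function (\<lambda>x::'a. (x, 0::'b))"
    by (intro polynomial_function_bounded_linear bounded_linear_intros)
  from sa_polynomial_subst[OF * this]
  have "sa (\<lambda>x. \<exists>c. P (x, (\<Sum>b\<in>Basis. c b *\<^sub>R b)))" by simp
  moreover have "(\<exists>c. P (x, (\<Sum>b\<in>Basis. c b *\<^sub>R b))) = (\<exists>y. P (x, y))" for x
    by (metis euclidean_representation)
  ultimately show ?thesis by simp
qed

lemma sa_ex2:
  fixes P :: "'a::real_normed_vector \<Rightarrow> 'b::euclidean_space \<Rightarrow> bool"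
  shows "sa (\<lambda>z. P (fst z) (snd z)) \<Longrightarrow> sa (\<lambda>x. \<exists>y. P x y)"
  using sa_ex[of "\<lambda>z. P (fst z) (snd z)"] by simp

lemma sa_all2:
  fixes P :: "'a::real_normed_vector \<Rightarrow> 'b::euclidean_space \<Rightarrow> bool"
  assumes "sa (\<lambda>z. P (fst z) (snd z))"
  shows "sa (\<lambda>x. \<forall>y. P x y)"
  using sa_not[OF sa_ex2[of "\<lambda>x y. \<not> P x y", OF sa_not[OF assms]]] by simp

text \<open>With graphs, substituting a function into a predicate or another function becomes an
  existential over its value, so closure under composition is quantifier elimination.\<close>

definition sa_fun :: "('a::real_normed_vector \<Rightarrow> 'b::euclidean_space) \<Rightarrow> bool" where
  "sa_fun f \<longleftrightarrow> sa (\<lambda>z. snd z = f (fst z))"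

lemma sa_comp:
  assumes "sa P" "sa_fun f"
  shows "sa (\<lambda>x. P (f x))"
proof -
  have "sa (\<lambda>x. \<exists>y. y = f x \<and> P y)"
    using assms(2) sa_polynomial_subst[OF assms(1) polynomial_function_bounded_linear[OF bounded_linear_snd]]
    unfolding sa_fun_def by (intro sa_ex2 sa_conj) auto
  then show ?thesis by simp
qed

lemma sa_fun_polynomial:
  fixes f :: "'a::real_normed_vector \<Rightarrow> 'b::euclidean_space"
  assumes "polynomial_function f"
  shows "sa_fun f"
proof -
  have fst: "polynomial_function (fst :: 'a \<times> 'b \<Rightarrow> 'a)"
    by (intro polynomial_function_bounded_linear bounded_linear_fst)
  have *: "real_polynomial_function (\<lambda>z::'a \<times> 'b. snd z \<bullet> b - f (fst z) \<bullet> b)" if b: "b \<in> Basis" for b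
  proof (rule real_polynomial_function_diff)
    have "real_polynomial_function (\<lambda>x. f x \<bullet> b)"
      using assms b by (simp add: polynomial_function_iff_Basis_inner)
    from real_polynomial_function_compose[OF fst this]
    show "real_polynomial_function (\<lambda>z::'a \<times> 'b. f (fst z) \<bullet> b)" by (simp add: o_def)
    show "real_polynomial_function (\<lambda>z::'a \<times> 'b. snd z \<bullet> b)"
      by (intro real_polynomial_function.intros(1) bounded_linear_intros)
  qed
  have "sa (\<lambda>z. \<forall>b\<in>Basis. snd z \<bullet> b - f (fst z) \<bullet> b = 0)"
    by (intro sa_Ball sa_poly_sign * finite_Basis)
  then show ?thesis unfolding sa_fun_def by (simp add: euclidean_eq_iff[where 'a='b])
qed

lemma sa_fun_comp:
  fixes f :: "'b::euclidean_space \<Rightarrow> 'c::euclidean_space" and g :: "'a::real_normed_vector \<Rightarrow> 'b"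
  assumes "sa_fun f" "sa_fun g"
  shows "sa_fun (\<lambda>x. f (g x))"
proof -
  have 1: "polynomial_function (\<lambda>w::('a \<times> 'c) \<times> 'b. (fst (fst w), snd w))"
    and 2: "polynomial_function (\<lambda>w::('a \<times> 'c) \<times> 'b. (snd w, snd (fst w)))"
    by (intro polynomial_function_bounded_linear bounded_linear_intros)+
  have "sa (\<lambda>z. \<exists>t. t = g (fst z) \<and> snd z = f t)"
    using sa_polynomial_subst[OF assms(2)[unfolded sa_fun_def] 1]
      sa_polynomial_subst[OF assms(1)[unfolded sa_fun_def] 2]
    by (intro sa_ex2 sa_conj) auto
  then show ?thesis by (simp add: sa_fun_def)
qed

lemma sa_fun_Pair:
  fixes f :: "'a::real_normed_vector \<Rightarrow> 'b::euclidean_space" and g :: "'a \<Rightarrow> 'c::euclidean_space"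
  assumes "sa_fun f" "sa_fun g"
  shows "sa_fun (\<lambda>x. (f x, g x))"
proof -
  have 1: "polynomial_function (\<lambda>w::'a \<times> ('b \<times> 'c). (fst w, fst (snd w)))"
    and 2: "polynomial_function (\<lambda>w::'a \<times> ('b \<times> 'c). (fst w, snd (snd w)))"
    by (intro polynomial_function_bounded_linear bounded_linear_intros)+
  have "sa (\<lambda>z. fst (snd z) = f (fst z) \<and> snd (snd z) = g (fst z))"
    using sa_polynomial_subst[OF assms(1)[unfolded sa_fun_def] 1]
      sa_polynomial_subst[OF assms(2)[unfolded sa_fun_def] 2]
    by (intro sa_conj) auto
  then show ?thesis by (simp add: sa_fun_def prod_eq_iff)
qed

lemma sa_fun_linear: "bounded_linear f \<Longrightarrow> sa_fun f"
  by (intro sa_fun_polynomial polynomial_function_bounded_linear)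

lemma sa_fun_id: "sa_fun (\<lambda>x. x)"
  by (intro sa_fun_linear bounded_linear_ident)

lemma sa_fun_const: "sa_fun (\<lambda>x. c)"
  by (intro sa_fun_polynomial polynomial_function_const)

lemma sa_fun_fst:
  fixes f :: "'a::real_normed_vector \<Rightarrow> 'b::euclidean_space \<times> 'c::euclidean_space"
  shows "sa_fun f \<Longrightarrow> sa_fun (\<lambda>x. fst (f x))"
  by (rule sa_fun_comp[OF sa_fun_linear[OF bounded_linear_fst]])

lemma sa_fun_snd:
  fixes f :: "'a::real_normed_vector \<Rightarrow> 'b::euclidean_space \<times> 'c::euclidean_space"
  shows "sa_fun f \<Longrightarrow> sa_fun (\<lambda>x. snd (f x))"
  by (rule sa_fun_comp[OF sa_fun_linear[OF bounded_linear_snd]])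

lemma sa_fun_add:
  fixes f g :: "'a::real_normed_vector \<Rightarrow> 'b::euclidean_space"
  assumes "sa_fun f" "sa_fun g"
  shows "sa_fun (\<lambda>x. f x + g x)"
proof -
  have "sa_fun (\<lambda>z::'b \<times> 'b. fst z + snd z)"
    by (intro sa_fun_linear bounded_linear_intros)
  from sa_fun_comp[OF this sa_fun_Pair[OF assms]] show ?thesis by simp
qed

lemma sa_fun_diff:
  fixes f g :: "'a::real_normed_vector \<Rightarrow> 'b::euclidean_space"
  assumes "sa_fun f" "sa_fun g"
  shows "sa_fun (\<lambda>x. f x - g x)"
proof -
  have "sa_fun (\<lambda>z::'b \<times> 'b. fst z - snd z)"
    by (intro sa_fun_linear bounded_linear_intros)
  from sa_fun_comp[OF this sa_fun_Pair[OF assms]] show ?thesis by simp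
qed

lemma sa_fun_scaleR:
  fixes f :: "'a::real_normed_vector \<Rightarrow> real" and g :: "'a \<Rightarrow> 'b::euclidean_space"
  assumes "sa_fun f" "sa_fun g"
  shows "sa_fun (\<lambda>x. f x *\<^sub>R g x)"
proof -
  have "sa_fun (\<lambda>z::real \<times> 'b. fst z *\<^sub>R snd z)"
    by (intro sa_fun_polynomial polynomial_function_mult polynomial_function_bounded_linear
        bounded_linear_fst bounded_linear_snd)
  from sa_fun_comp[OF this sa_fun_Pair[OF assms]] show ?thesis by simp
qed

lemma sa_fun_mult:
  fixes f g :: "'a::real_normed_vector \<Rightarrow> real"
  shows "sa_fun f \<Longrightarrow> sa_fun g \<Longrightarrow> sa_fun (\<lambda>x. f x * g x)"
  using sa_fun_scaleR[of f g] by simp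

lemma sa_fun_inner:
  fixes f g :: "'a::real_normed_vector \<Rightarrow> 'b::euclidean_space"
  assumes "sa_fun f" "sa_fun g"
  shows "sa_fun (\<lambda>x. f x \<bullet> g x)"
proof -
  have "real_polynomial_function (\<lambda>z::'b \<times> 'b. \<Sum>b\<in>Basis. (fst z \<bullet> b) * (snd z \<bullet> b))"
    by (intro real_polynomial_function_sum finite_Basis real_polynomial_function.intros(4)
        real_polynomial_function.intros(1) bounded_linear_intros)
  then have "sa_fun (\<lambda>z::'b \<times> 'b. fst z \<bullet> snd z)"
    by (intro sa_fun_polynomial, subst euclidean_inner) (simp add: real_polynomial_function_eq)
  from sa_fun_comp[OF this sa_fun_Pair[OF assms]] show ?thesis by simp
qed

lemma sa_less:
  fixes f g :: "'a::real_normed_vector \<Rightarrow> real"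
  assumes "sa_fun f" "sa_fun g"
  shows "sa (\<lambda>x. f x < g x)"
proof -
  have "sa (\<lambda>y::real. y > 0)"
    by (intro sa_poly_sign real_polynomial_function.intros(1) bounded_linear_ident)
  from sa_comp[OF this sa_fun_diff[OF assms(2,1)]] show ?thesis by simp
qed

lemma sa_le:
  fixes f g :: "'a::real_normed_vector \<Rightarrow> real"
  assumes "sa_fun f" "sa_fun g"
  shows "sa (\<lambda>x. f x \<le> g x)"
  using sa_not[OF sa_less[OF assms(2,1)]] by (simp add: not_less)

lemma sa_eq:
  fixes f g :: "'a::real_normed_vector \<Rightarrow> 'b::euclidean_space"
  assumes "sa_fun f" "sa_fun g"
  shows "sa (\<lambda>x. f x = g x)"
proof -
  have "sa (\<lambda>z::'b \<times> 'b. snd z = fst z)"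
    using sa_fun_id[where 'a='b] by (simp only: sa_fun_def)
  from sa_comp[OF this sa_fun_Pair[OF assms(2,1)]] show ?thesis by simp
qed

lemma sa_fun_divide_const: "sa_fun f \<Longrightarrow> sa_fun (\<lambda>x. f x / (c::real))"
  using sa_fun_mult[OF sa_fun_const[of "1 / c"], of f] by simp

lemma sa_fun_minus: "sa_fun f \<Longrightarrow> sa_fun (\<lambda>x. - f x)"
  using sa_fun_diff[OF sa_fun_const[of 0], of f] by simp

lemmas sa_intros = sa_const sa_not sa_conj sa_disj sa_imp sa_ex2 sa_all2 sa_less sa_le sa_eq
  sa_fun_id sa_fun_fst sa_fun_snd sa_fun_add sa_fun_diff sa_fun_mult sa_fun_scaleR sa_fun_inner
  sa_fun_const sa_fun_divide_const sa_fun_minus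

text \<open>The norm is not polynomial, but its graph is cut out by \<open>0 \<le> t\<close> and
  \<open>y \<bullet> y = t * t\<close>.\<close>

lemma sa_fun_norm:
  fixes f :: "'a::real_normed_vector \<Rightarrow> 'b::euclidean_space"
  assumes "sa_fun f"
  shows "sa_fun (\<lambda>x. norm (f x))"
proof -
  have "sa (\<lambda>z::'b \<times> real. 0 \<le> snd z \<and> fst z \<bullet> fst z = snd z * snd z)"
    by (intro sa_intros)
  moreover have "(0 \<le> t \<and> y \<bullet> y = t * t) = (t = norm y)" for y :: 'b and t
    by (auto simp: norm_eq_sqrt_inner power2_eq_square[symmetric])
  ultimately have "sa_fun (norm :: 'b \<Rightarrow> real)" by (simp add: sa_fun_def)
  from sa_fun_comp[OF this assms] show ?thesis .
qed

lemma sa_comp2: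
  fixes f :: "'a::real_normed_vector \<Rightarrow> 'b::euclidean_space" and g :: "'a \<Rightarrow> 'c::euclidean_space"
  assumes "sa (\<lambda>z. S (fst z) (snd z))" "sa_fun f" "sa_fun g"
  shows "sa (\<lambda>x. S (f x) (g x))"
  using sa_comp[OF assms(1) sa_fun_Pair[OF assms(2,3)]] by simp

section \<open>Semialgebraic subsets of the line\<close>

lemma sa_real_breakpoints:
  fixes Q :: "real \<Rightarrow> bool"
  assumes "sa Q"
  shows "\<exists>Z. finite Z \<and> (\<forall>x y. x < y \<longrightarrow> {x..y} \<inter> Z = {} \<longrightarrow> Q x = Q y)"
proof -
  \<comment> \<open>A dummy parameter, fixed to 0 below, makes the real argument the distinguished
    variable; the roots of the finitely many nonzero members are the breakpoints.\<close>
  have "sa (\<lambda>z::real \<times> real. Q (snd z))"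
    by (rule sa_comp[OF assms]) (intro sa_intros)
  from sa_cells[OF this] obtain C :: "(nat \<times> (real \<Rightarrow> real poly)) set" where C: "finite C"
    "\<And>x y x' y'. (\<And>p. p \<in> C \<Longrightarrow> sgn (poly (snd p x) y) = sgn (poly (snd p x') y')) \<Longrightarrow>
       Q (snd (x, y)) = Q (snd (x', y'))"
    by metis
  define Z where "Z = (\<Union>p\<in>C. if snd p 0 = 0 then {} else {z. poly (snd p 0) z = 0})"
  have "finite Z" unfolding Z_def using C(1) by (auto simp: poly_roots_finite)
  moreover have "Q x = Q y" if "x < y" "{x..y} \<inter> Z = {}" for x y
  proof (rule C(2)[unfolded snd_conv])
    fix p assume p: "p \<in> C"
    show "sgn (poly (snd p 0) x) = sgn (poly (snd p 0) y)"
    proof (cases "snd p 0 = 0")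
      case False
      have "poly (snd p 0) z \<noteq> 0" if "x \<le> z" "z \<le> y" for z
      proof
        assume "poly (snd p 0) z = 0"
        then have "z \<in> Z" unfolding Z_def using p False by (intro UN_I[of p]) auto
        then show False using \<open>{x..y} \<inter> Z = {}\<close> that by auto
      qed
      then show ?thesis using poly_sgn_const_closed \<open>x < y\<close> by blast
    qed simp
  qed
  ultimately show ?thesis by blast
qed

text \<open>Promotes what holds for arbitrarily small \<open>h\<close> to all small
  \<open>h\<close>; it is applied to radii as well as to step sizes.\<close>

lemma sa_real_right_constant:
  fixes Q :: "real \<Rightarrow> bool"
  assumes "sa Q"
  shows "\<exists>e>0. (\<forall>h. 0 < h \<and> h < e \<longrightarrow> Q (a + h)) \<or> (\<forall>h. 0 < h \<and> h < e \<longrightarrow> \<not> Q (a + h))"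
proof -
  obtain Z where Z: "finite Z" "\<And>x y. x < y \<Longrightarrow> {x..y} \<inter> Z = {} \<Longrightarrow> Q x = Q y"
    using sa_real_breakpoints[OF assms] by blast
  obtain e where e: "e > 0" "\<And>z. z \<in> Z \<Longrightarrow> z \<noteq> a \<Longrightarrow> e \<le> dist a z"
    using finite_set_avoid[OF Z(1), of a] by blast
  have eq: "Q (a + h) = Q (a + k)" if "0 < h" "h < k" "k < e" for h k
  proof (rule Z(2))
    show "{a + h..a + k} \<inter> Z = {}"
      using e(2) that by (force simp: dist_real_def)
  qed (use that in simp)
  have const: "Q (a + h) = Q (a + e / 2)" if "0 < h" "h < e" for h
  proof (cases h "e / 2" rule: linorder_cases)
    case less then show ?thesis by (intro eq) (use that in auto)
  next
    case equal then show ?thesis by (simp only:)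
  next
    case greater then show ?thesis by (intro eq[symmetric]) (use that in auto)
  qed
  have "(\<forall>h. 0 < h \<and> h < e \<longrightarrow> Q (a + h)) \<or> (\<forall>h. 0 < h \<and> h < e \<longrightarrow> \<not> Q (a + h))"
    by (metis const)
  then show ?thesis using e(1) by blast
qed

text \<open>A solution off the finitely many breakpoints has a whole interval of solutions next to
  it. Together with an uncountability argument this provides bounds that are uniform on an
  interval.\<close>

lemma sa_real_infinite_interval:
  fixes Q :: "real \<Rightarrow> bool"
  assumes "sa Q" "infinite {y. Q y}"
  shows "\<exists>p q. p < q \<and> (\<forall>y. p \<le> y \<and> y \<le> q \<longrightarrow> Q y)"
proof -
  obtain Z where Z: "finite Z" "\<And>x y. x < y \<Longrightarrow> {x..y} \<inter> Z = {} \<Longrightarrow> Q x = Q y"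
    using sa_real_breakpoints[OF assms(1)] by blast
  obtain a where a: "Q a" "a \<notin> Z"
    using assms(2) Z(1) by (metis (mono_tags) finite_subset mem_Collect_eq subsetI)
  obtain e where e: "e > 0" "\<And>z. z \<in> Z \<Longrightarrow> z \<noteq> a \<Longrightarrow> e \<le> dist a z"
    using finite_set_avoid[OF Z(1), of a] by blast
  have "Q y" if "a < y" "y \<le> a + e / 2" for y
  proof -
    have "{a..y} \<inter> Z = {}" using e a(2) that by (force simp: dist_real_def)
    then show ?thesis using Z(2)[OF that(1)] a(1) by blast
  qed
  then show ?thesis using a(1) e(1)
    by (intro exI[of _ a] exI[of _ "a + e / 2"]) (auto simp: order.order_iff_strict)
qed

section \<open>Definable choice\<close>

text \<open>\<open>pick S\<close> singles out one element of \<open>S\<close> in first-order terms: the least one if it exists, and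
  otherwise the midpoint of the first interval, of length at most one, that follows the infimum.\<close>

definition pick :: "(real \<Rightarrow> bool) \<Rightarrow> real \<Rightarrow> bool" where
  "pick S t \<longleftrightarrow> (S t \<and> (\<forall>s. S s \<longrightarrow> t \<le> s)) \<or>
     (\<exists>m e. 0 < e \<and> e \<le> 1 \<and> (\<forall>s. S s \<longrightarrow> m < s) \<and> (\<forall>s. m < s \<and> s < m + e \<longrightarrow> S s) \<and>
        (\<forall>e'. e < e' \<and> e' \<le> 1 \<longrightarrow> \<not> (\<forall>s. m < s \<and> s < m + e' \<longrightarrow> S s)) \<and> t = m + e / 2)"

lemma pick_mem: "pick S t \<Longrightarrow> S t"
  unfolding pick_def by auto

lemma pick_unique:
  assumes "pick S t" "pick S t'"
  shows "t = t'"
proof -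
  define M where "M m e t \<longleftrightarrow> 0 < e \<and> e \<le> 1 \<and> (\<forall>s. S s \<longrightarrow> m < s) \<and> (\<forall>s. m < s \<and> s < m + e \<longrightarrow> S s) \<and>
     (\<forall>e'. e < e' \<and> e' \<le> 1 \<longrightarrow> \<not> (\<forall>s. m < s \<and> s < m + e' \<longrightarrow> S s)) \<and> t = m + e / 2" for m e t
  define L where "L t \<longleftrightarrow> S t \<and> (\<forall>s. S s \<longrightarrow> t \<le> s)" for t
  have pick: "pick S t \<longleftrightarrow> L t \<or> (\<exists>m e. M m e t)" for t
    by (simp add: pick_def M_def L_def)
  have disj: False if "L t" "M m e t'" for t t' m e
  proof -
    have "m < t" using that by (auto simp: L_def M_def)
    define s where "s = min (m + e / 2) ((m + t) / 2)"
    have "m < s" "s < m + e" "s < t" using \<open>m < t\<close> that(2) by (auto simp: s_def M_def min_def)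
    then have "S s" using that(2) by (simp add: M_def)
    then show False using that(1) \<open>s < t\<close> by (auto simp: L_def)
  qed
  have not_lt: False if "M m e t" "M m' e' t'" "m < m'" for m e t m' e' t'
  proof -
    \<comment> \<open>A point of \<open>S\<close> not above \<open>m'\<close>, although
      \<open>m'\<close> lies strictly below \<open>S\<close>. So \<open>m\<close> is unique, and
      with it the maximal \<open>e\<close>.\<close>
    define s where "s = min (m + e / 2) m'"
    have "m < s" "s < m + e" "s \<le> m'" using that by (auto simp: s_def M_def min_def)
    then have "S s" using that(1) by (simp add: M_def)
    then show False using that(2) \<open>s \<le> m'\<close> unfolding M_def by (metis not_le)
  qed
  have MM: "t = t'" if t: "M m e t" "M m' e' t'" for m e m' e'
  proof -
    have m: "m = m'" using not_lt t by (metis linorder_neqE_linordered_idom)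
    have "\<not> e < e'" "\<not> e' < e" using t unfolding M_def m by blast+
    then show ?thesis using t m by (simp add: M_def)
  qed
  have LL: "t = t'" if "L t" "L t'"
    using that by (auto simp: L_def intro: antisym)
  from assms show ?thesis
    unfolding pick using MM LL disj by (elim disjE exE) blast+
qed

text \<open>\<open>right\<close> is applied at the infimum: if that is not attained, elements of
  \<open>S\<close> accumulate there from the right, so a whole interval next to it lies in
  \<open>S\<close>. The cap 1 keeps the supremum of the admissible lengths finite.\<close>

lemma pick_exists:
  assumes S: "S s0" and lower: "\<And>s. S s \<Longrightarrow> l \<le> s"
    and right: "\<And>a. \<exists>e>0. (\<forall>h. 0 < h \<and> h < e \<longrightarrow> S (a + h)) \<or> (\<forall>h. 0 < h \<and> h < e \<longrightarrow> \<not> S (a + h))"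
  shows "\<exists>t. pick S t"
proof -
  define m where "m = Inf {s. S s}"
  have ne: "{s. S s} \<noteq> {}" and bdd: "bdd_below {s. S s}" using S lower by (auto intro!: bdd_belowI[of _ l])
  have m: "m \<le> s" if "S s" for s
    unfolding m_def using that bdd by (intro cInf_lower) auto
  show ?thesis
  proof (cases "S m")
    case True
    then show ?thesis using m by (intro exI[of _ m]) (simp add: pick_def)
  next
    case False
    then have m': "m < s" if "S s" for s using m[OF that] that by (metis order.order_iff_strict)
    obtain e where e: "e > 0" "(\<forall>h. 0 < h \<and> h < e \<longrightarrow> S (m + h)) \<or> (\<forall>h. 0 < h \<and> h < e \<longrightarrow> \<not> S (m + h))"
      using right by blast
    have "\<exists>s. S s \<and> s < m + e"
      using cInf_lessD[OF ne, of "m + e"] e(1) by (auto simp: m_def)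
    then obtain s1 where "S s1" "s1 < m + e" by blast
    then have "\<not> (\<forall>h. 0 < h \<and> h < e \<longrightarrow> \<not> S (m + h))"
      using m'[of s1] by (auto intro!: exI[of _ "s1 - m"])
    then have Se: "S (m + h)" if "0 < h" "h < e" for h using e(2) that by blast
    define E where "E = {e. 0 < e \<and> e \<le> 1 \<and> (\<forall>s. m < s \<and> s < m + e \<longrightarrow> S s)}"
    have "S s" if "m < s" "s < m + min e 1" for s using Se[of "s - m"] that by auto
    then have mem: "min e 1 \<in> E" using e(1) by (auto simp: E_def)
    then have Ene: "E \<noteq> {}" by auto
    have bddE: "bdd_above E" by (auto simp: E_def intro!: bdd_aboveI[of _ 1])
    have up: "x \<le> Sup E" if "x \<in> E" for x using cSup_upper[OF that bddE] .
    have "0 < Sup E" using up[OF mem] e(1) by (auto simp: min_def split: if_splits)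
    moreover have "Sup E \<le> 1" using Ene by (intro cSup_least) (auto simp: E_def)
    moreover have "S s" if "m < s" "s < m + Sup E" for s
    proof -
      have "s - m < Sup E" using that(2) by simp
      from less_cSupD[OF Ene this] obtain x where "x \<in> E" "s - m < x" by blast
      then show ?thesis using that by (auto simp: E_def)
    qed
    moreover have "\<not> (\<forall>s. m < s \<and> s < m + x \<longrightarrow> S s)" if "Sup E < x" "x \<le> 1" for x
      using up[of x] that \<open>0 < Sup E\<close> by (auto simp: E_def)
    ultimately have "pick S (m + Sup E / 2)"
      unfolding pick_def using m' by (intro disjI2 exI[of _ m] exI[of _ "Sup E"]) auto
    then show ?thesis by blast
  qed
qed

lemma sa_pick:
  fixes S :: "'a::euclidean_space \<Rightarrow> real \<Rightarrow> bool"
  assumes "sa (\<lambda>z. S (fst z) (snd z))"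
  shows "sa (\<lambda>z. pick (S (fst z)) (snd z))"
  unfolding pick_def by (intro sa_intros sa_comp2[where S=S, OF assms])

text \<open>Coordinates are fixed one after the other: \<open>pick\<close> selects a value in the
  projection of the fibre to one coordinate, and the fibre shrinks to the points with that value
  until it is a singleton. The bound \<open>K\<close> keeps each projection bounded below, as
  \<open>pick_exists\<close> requires.\<close>

lemma sa_choice:
  fixes P :: "'a::euclidean_space \<times> 'b::euclidean_space \<Rightarrow> bool"
  assumes P: "sa P" and bound: "\<And>a b. P (a, b) \<Longrightarrow> norm b \<le> K"
  shows "\<exists>f. sa_fun f \<and> (\<forall>a. (\<exists>b. P (a, b)) \<longrightarrow> P (a, f a))"
proof -
  have "\<exists>P'. sa P' \<and> (\<forall>z. P' z \<longrightarrow> P z) \<and> (\<forall>a. (\<exists>b. P (a, b)) \<longrightarrow> (\<exists>b. P' (a, b))) \<and>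
     (\<forall>a b b' i. i \<in> B \<longrightarrow> P' (a, b) \<longrightarrow> P' (a, b') \<longrightarrow> b \<bullet> i = b' \<bullet> i)"
    if "finite B" "B \<subseteq> Basis" for B
    using that
  proof (induction B rule: finite_induct)
    case empty
    then show ?case using P by blast
  next
    case (insert i B)
    then obtain P' where P': "sa P'" "\<And>z. P' z \<Longrightarrow> P z" "\<And>a. (\<exists>b. P (a, b)) \<Longrightarrow> (\<exists>b. P' (a, b))"
     "\<And>a b b' i. i \<in> B \<Longrightarrow> P' (a, b) \<Longrightarrow> P' (a, b') \<Longrightarrow> b \<bullet> i = b' \<bullet> i"
      by auto
    define S where "S a t \<longleftrightarrow> (\<exists>b. P' (a, b) \<and> b \<bullet> i = t)" for a t
    have saS: "sa (\<lambda>z. S (fst z) (snd z))"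
      unfolding S_def by (intro sa_intros sa_comp[OF P'(1)] sa_fun_Pair)
    define P'' where "P'' z \<longleftrightarrow> P' z \<and> pick (S (fst z)) (snd z \<bullet> i)" for z
    have "sa P''"
      unfolding P''_def by (intro sa_intros P'(1) sa_comp2[where S="\<lambda>a. pick (S a)", OF sa_pick[OF saS]])
    moreover have "\<exists>b. P'' (a, b)" if ex: "\<exists>b. P (a, b)" for a
    proof -
      obtain b where "P' (a, b)" using P'(3)[OF ex] by blast
      then have "S a (b \<bullet> i)" by (auto simp: S_def)
      moreover have "- K \<le> t" if "S a t" for t
      proof -
        obtain b where "P (a, b)" "b \<bullet> i = t" using \<open>S a t\<close> P'(2) by (auto simp: S_def)
        then have "\<bar>t\<bar> \<le> K"
          using bound[of a b] Basis_le_norm[of i b] insert.prems by auto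
        then show ?thesis by simp
      qed
      moreover have "sa (S a)"
        using sa_comp2[where S=S, OF saS sa_fun_const sa_fun_id] .
      ultimately obtain t where t: "pick (S a) t"
        using pick_exists[of "S a" "b \<bullet> i" "- K", OF _ _ sa_real_right_constant] by blast
      then obtain b' where "P' (a, b')" "b' \<bullet> i = t" using pick_mem[OF t] by (auto simp: S_def)
      then show ?thesis using t by (auto simp: P''_def)
    qed
    moreover have "b \<bullet> j = b' \<bullet> j" if "j \<in> insert i B" "P'' (a, b)" "P'' (a, b')" for a b b' j
      using that P'(4)[of j a b b'] pick_unique[of "S a" "b \<bullet> i" "b' \<bullet> i"] by (auto simp: P''_def)
    moreover have "\<forall>z. P'' z \<longrightarrow> P z" using P'(2) by (simp add: P''_def)
    ultimately show ?case by blast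
  qed
  from this[OF finite_Basis subset_refl] obtain P' where P': "sa P'" "\<And>z. P' z \<Longrightarrow> P z"
    "\<And>a. (\<exists>b. P (a, b)) \<Longrightarrow> (\<exists>b. P' (a, b))"
    "\<And>a b b' i. i \<in> Basis \<Longrightarrow> P' (a, b) \<Longrightarrow> P' (a, b') \<Longrightarrow> b \<bullet> i = b' \<bullet> i"
    by blast
  have uniq: "b = b'" if "P' (a, b)" "P' (a, b')" for a b b'
    using P'(4)[OF _ that] by (rule euclidean_eqI)
  \<comment> \<open>Where the fibre is empty, the default 0 makes \<open>f\<close> total with a
    graph that is still semialgebraic.\<close>
  define f where "f a = (if \<exists>b. P' (a, b) then THE b. P' (a, b) else 0)" for a
  have f: "P' (a, f a)" if "P' (a, b)" for a b
    using that theI'[of "\<lambda>b. P' (a, b)"] uniq unfolding f_def by auto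
  have graph: "t = f a \<longleftrightarrow> P' (a, t) \<or> (\<not> (\<exists>b. P' (a, b)) \<and> t = 0)" for a t
  proof (cases "\<exists>b. P' (a, b)")
    case True
    then show ?thesis using f uniq by blast
  next
    case False
    then show ?thesis by (auto simp: f_def)
  qed
  have "sa (\<lambda>z. P' (fst z, snd z) \<or> (\<not> (\<exists>b. P' (fst z, b)) \<and> snd z = 0))"
    by (intro sa_intros sa_comp[OF P'(1)] sa_fun_Pair)
  then have "sa_fun f" unfolding sa_fun_def graph .
  then show ?thesis using P'(2,3) f by blast
qed

section \<open>Semialgebraic functions of one variable\<close>

text \<open>If the left difference quotients of \<open>f\<close> stayed above \<open>\<eta> / r\<close> near \<open>0\<close>, then so would, up to a
  factor, the right ones: otherwise both one-sided bounds would hold uniformly on some interval, where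
  they contradict each other. Hence \<open>f\<close> would increase by a fixed amount on every \<open>[\<rho>, 2\<rho>]\<close>,
  against boundedness.\<close>

lemma sa_fun_left_slope_le:
  fixes f :: "real \<Rightarrow> real"
  assumes f: "sa_fun f" and "0 < d" and bound: "\<And>r. 0 < r \<Longrightarrow> r < d \<Longrightarrow> \<bar>f r\<bar> \<le> 1" and "0 < \<eta>"
  shows "\<exists>d'>0. \<forall>r. 0 < r \<and> r < d' \<longrightarrow> (\<exists>e>0. \<forall>h. 0 < h \<and> h < e \<longrightarrow> r * (f r - f (r - h)) \<le> \<eta> * h)"
proof (rule ccontr)
  assume contra: "\<not> ?thesis"
  note intros = sa_intros sa_fun_comp[OF f]
  define A where "A r \<longleftrightarrow> (\<exists>e. 0 < e \<and> (\<forall>h. 0 < h \<and> h < e \<longrightarrow> r * (f r - f (r - h)) \<le> \<eta> * h))" for r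
  have "sa A" unfolding A_def by (intro intros)
  then obtain e1 where e1: "e1 > 0" "\<And>r. 0 < r \<Longrightarrow> r < e1 \<Longrightarrow> \<not> A r"
  proof -
    \<comment> \<open>Violations of \<open>A\<close> at arbitrarily small radii exclude one half of
      the dichotomy, so \<open>A\<close> fails at every small radius.\<close>
    have "\<forall>d'>0. \<exists>r. 0 < r \<and> r < d' \<and> \<not> A r" using contra unfolding A_def by blast
    then show ?thesis using that sa_real_right_constant[OF \<open>sa A\<close>, of 0] unfolding add_0 by blast
  qed
  have L: "\<exists>e>0. \<forall>h. 0 < h \<and> h < e \<longrightarrow> r * (f r - f (r - h)) > \<eta> * h" if r: "0 < r" "r < e1" for r
  proof -
    have "sa (\<lambda>h. r * (f r - f (r - h)) \<le> \<eta> * h)" by (intro intros)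
    from sa_real_right_constant[OF this, of 0, unfolded add_0 not_le] e1(2)[OF r] show ?thesis
      unfolding A_def by blast
  qed
  \<comment> \<open>Half of \<eta>, because the left slope at \<open>p + h\<close> and the right
    slope at \<open>p\<close> carry the factors \<open>p + h\<close> and \<open>p\<close>, whose
    ratio is at most 2 for \<open>h \<le> p\<close>.\<close>
  define R where "R r \<longleftrightarrow> (\<exists>e. 0 < e \<and> (\<forall>h. 0 < h \<and> h < e \<longrightarrow> r * (f (r + h) - f r) \<ge> \<eta> / 2 * h))" for r
  have "sa R" unfolding R_def by (intro intros)
  then obtain e2 where e2: "e2 > 0"
    "(\<forall>r. 0 < r \<and> r < e2 \<longrightarrow> R r) \<or> (\<forall>r. 0 < r \<and> r < e2 \<longrightarrow> \<not> R r)"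
    using sa_real_right_constant[of R 0] by auto
  define D where "D = min d (min e1 e2)"
  have D: "D > 0" "D \<le> d" "D \<le> e1" "D \<le> e2" using \<open>0 < d\<close> e1 e2 by (auto simp: D_def)
  show False
  proof (cases "\<forall>r. 0 < r \<and> r < e2 \<longrightarrow> R r")
    case False
    then have notR: "\<not> R r" if "0 < r" "r < D" for r using e2(2) D that by auto
    \<comment> \<open>The admissible step sizes depend on \<open>r\<close>. Countably many sets
      \<open>U n\<close> cover an uncountable interval, so some \<open>U n\<close> is infinite and
      contains an interval on which one step size works.\<close>
    define U where "U n r \<longleftrightarrow> 0 < r \<and> r < D \<and>
       (\<forall>h. 0 < h \<and> h < 1 / real (Suc n) \<longrightarrow> r * (f r - f (r - h)) > \<eta> * h \<and> r * (f (r + h) - f r) < \<eta> / 2 * h)" for n r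
    have "\<exists>n. U n r" if r: "0 < r" "r < D" for r
    proof -
      have "sa (\<lambda>h. r * (f (r + h) - f r) \<ge> \<eta> / 2 * h)" by (intro intros)
      from sa_real_right_constant[OF this, of 0, unfolded add_0 not_le] notR[OF r]
      obtain eR where eR: "eR > 0" "\<And>h. 0 < h \<Longrightarrow> h < eR \<Longrightarrow> r * (f (r + h) - f r) < \<eta> / 2 * h"
        unfolding R_def by blast
      obtain eL where eL: "eL > 0" "\<And>h. 0 < h \<Longrightarrow> h < eL \<Longrightarrow> r * (f r - f (r - h)) > \<eta> * h"
        using L[of r] r D by auto
      obtain n where "1 / real (Suc n) < min eL eR"
        using eR(1) eL(1) nat_approx_posE[of "min eL eR"] by auto
      then have "U n r" unfolding U_def using r eL(2) eR(2) by auto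
      then show ?thesis by blast
    qed
    then have "{0<..<D} \<subseteq> (\<Union>n. {r. U n r})" by auto
    moreover have "uncountable {0<..<D}" using D(1) by (simp add: uncountable_open_interval)
    ultimately have "uncountable (\<Union>n. {r. U n r})" using countable_subset by blast
    then obtain n where "infinite {r. U n r}"
      by (metis countable_UN countable_finite countableI_type)
    moreover have "sa (U n)" unfolding U_def by (intro intros)
    ultimately obtain p q where pq: "p < q" "\<And>y. p \<le> y \<Longrightarrow> y \<le> q \<Longrightarrow> U n y"
      using sa_real_infinite_interval[of "U n"] by blast
    have p: "0 < p" using pq(2)[of p] pq(1) by (simp add: U_def)
    \<comment> \<open>\<open>h \<le> q - p\<close> keeps \<open>p + h\<close> in the interval, so
      one increment is seen from \<open>p + h\<close> to the left and from \<open>p\<close> to the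
      right.\<close>
    define h where "h = min (min (q - p) p) (1 / (2 * real (Suc n)))"
    have h: "0 < h" "h \<le> q - p" "h \<le> p" "h < 1 / real (Suc n)"
    proof -
      show "0 < h" "h \<le> q - p" "h \<le> p" using pq(1) p by (auto simp: h_def)
      have "1 / (2 * real (Suc n)) < 1 / real (Suc n)" by (simp add: field_simps)
      then show "h < 1 / real (Suc n)" unfolding h_def by linarith
    qed
    define \<Delta> where "\<Delta> = f (p + h) - f p"
    have 1: "(p + h) * \<Delta> > \<eta> * h" using pq(2)[of "p + h"] h pq(1) by (auto simp: U_def \<Delta>_def)
    have 2: "p * \<Delta> < \<eta> / 2 * h" using pq(2)[of p] h pq(1) by (auto simp: U_def \<Delta>_def)
    have "\<eta> * h > 0" using \<open>0 < \<eta>\<close> h by simp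
    with 1 have "(p + h) * \<Delta> > 0" by linarith
    then have "\<Delta> > 0" using p h by (simp add: zero_less_mult_iff)
    then have "(p + h) * \<Delta> \<le> (2 * p) * \<Delta>" using h by (intro mult_right_mono) auto
    then show False using 1 2 by linarith
  next
    case True
    have double: "f \<rho> \<le> f (2 * \<rho>) - \<eta> / 4" if \<rho>: "0 < \<rho>" "2 * \<rho> < D" for \<rho>
    proof -
      have "4 * \<rho> * (f (2 * \<rho>) - f \<rho>) \<ge> \<eta> * (2 * \<rho> - \<rho>)"
      \<comment> \<open>Bisection glues the local bounds without continuity of \<open>f\<close>. The
        factor \<open>4 * \<rho>\<close> combines \<open>x \<le> 2 * \<rho>\<close> with the halved
        constant of the right slopes.\<close>
      proof (rule Bolzano[of \<rho> "2 * \<rho>" "\<lambda>u v. 4 * \<rho> * (f v - f u) \<ge> \<eta> * (v - u)"])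
        show "\<rho> \<le> 2 * \<rho>" using \<rho> by simp
        fix a b c
        assume "\<eta> * (b - a) \<le> 4 * \<rho> * (f b - f a)" "\<eta> * (c - b) \<le> 4 * \<rho> * (f c - f b)"
        then show "\<eta> * (c - a) \<le> 4 * \<rho> * (f c - f a)" by (simp add: algebra_simps)
      next
        fix x assume x: "\<rho> \<le> x" "x \<le> 2 * \<rho>"
        have xD: "0 < x" "x < D" using x \<rho> by auto
        obtain eL where eL: "eL > 0" "\<And>h. 0 < h \<Longrightarrow> h < eL \<Longrightarrow> x * (f x - f (x - h)) > \<eta> * h"
          using L[of x] xD D by auto
        have "R x" using True xD D by auto
        then obtain eR where eR: "eR > 0" "\<And>h. 0 < h \<Longrightarrow> h < eR \<Longrightarrow> x * (f (x + h) - f x) \<ge> \<eta> / 2 * h"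
          unfolding R_def by auto
        have left: "4 * \<rho> * (f x - f u) \<ge> \<eta> * (x - u)" if "u \<le> x" "x - u < eL" for u
        proof (cases "u = x")
          case False
          then have *: "x * (f x - f u) > \<eta> * (x - u)" using eL(2)[of "x - u"] that by simp
          have "\<eta> * (x - u) \<ge> 0" using that \<open>0 < \<eta>\<close> by simp
          with * have "x * (f x - f u) > 0" by linarith
          then have "f x - f u > 0" using xD by (simp add: zero_less_mult_iff)
          then have "x * (f x - f u) \<le> 4 * \<rho> * (f x - f u)"
            using x xD by (intro mult_right_mono) auto
          then show ?thesis using * by linarith
        qed simp
        have right: "4 * \<rho> * (f v - f x) \<ge> \<eta> * (v - x)" if "x \<le> v" "v - x < eR" for v
        proof (cases "v = x")
          case False
          then have *: "x * (f v - f x) \<ge> \<eta> / 2 * (v - x)" using eR(2)[of "v - x"] that by simp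
          have "\<eta> / 2 * (v - x) \<ge> 0" using that \<open>0 < \<eta>\<close> by simp
          with * have "x * (f v - f x) \<ge> 0" by linarith
          then have "f v - f x \<ge> 0" using xD by (simp add: zero_le_mult_iff)
          then have "(2 * x) * (f v - f x) \<le> 4 * \<rho> * (f v - f x)"
            using x xD by (intro mult_right_mono) auto
          moreover have "(2 * x) * (f v - f x) = 2 * (x * (f v - f x))"
              "\<eta> * (v - x) = 2 * (\<eta> / 2 * (v - x))" by simp_all
          ultimately show ?thesis using * by linarith
        qed simp
        show "\<exists>d>0. \<forall>a b. a \<le> x \<and> x \<le> b \<and> b - a < d \<longrightarrow> \<eta> * (b - a) \<le> 4 * \<rho> * (f b - f a)"
        proof (intro exI[of _ "min eL eR"] conjI allI impI)
          show "0 < min eL eR" using eL eR by simp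
          fix a b assume "a \<le> x \<and> x \<le> b \<and> b - a < min eL eR"
          then have "\<eta> * (x - a) \<le> 4 * \<rho> * (f x - f a)" "\<eta> * (b - x) \<le> 4 * \<rho> * (f b - f x)"
            using left[of a] right[of b] by auto
          then show "\<eta> * (b - a) \<le> 4 * \<rho> * (f b - f a)" by (simp add: algebra_simps)
        qed
      qed
      then have "\<rho> * (\<eta> / 4) \<le> \<rho> * (f (2 * \<rho>) - f \<rho>)" by (simp add: algebra_simps)
      then show ?thesis using \<rho> by simp
    qed
    have small: "D / 2 / 2 ^ k < D" for k :: nat
      using divide_left_mono[of 1 "2 ^ k" "D / 2"] D(1) by simp
    \<comment> \<open>Each halving of the argument lowers the bound by \<open>\<eta> / 4\<close>, so
      \<open>f\<close> eventually drops below -1.\<close>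
    have iter: "f (D / 2 / 2 ^ k) \<le> 1 - real k * (\<eta> / 4)" for k
    proof (induction k)
      case 0
      then show ?case using bound[of "D / 2"] D by simp
    next
      case (Suc k)
      have "2 * (D / 2 / 2 ^ Suc k) < D" using small[of k] by simp
      then have "f (D / 2 / 2 ^ Suc k) \<le> f (2 * (D / 2 / 2 ^ Suc k)) - \<eta> / 4"
        using D(1) by (intro double) auto
      also have "2 * (D / 2 / 2 ^ Suc k) = D / 2 / 2 ^ k" by simp
      finally show ?case using Suc by (simp add: field_simps)
    qed
    have "0 < \<eta> / 4" using \<open>0 < \<eta>\<close> by simp
    then obtain k where "real k * (\<eta> / 4) > 2" using reals_Archimedean3 by blast
    moreover have "\<bar>f (D / 2 / 2 ^ k)\<bar> \<le> 1"
    proof (rule bound)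
      show "D / 2 / 2 ^ k < d" using small[of k] D by linarith
    qed (use D in simp)
    ultimately show False using iter[of k] by linarith
  qed
qed

section \<open>Near radiality\<close>

lemma sa_semialgebraic:
  fixes X :: "(real ^ 'n) set"
  assumes "semialgebraic X"
  shows "sa (\<lambda>x. x \<in> X)"
proof -
  have poly: "real_polynomial_function p" if "real_poly_fun p" for p :: "real ^ 'n \<Rightarrow> real"
    using that
  proof (induction p rule: real_poly_fun.induct)
    case (coord i)
    show ?case by (intro real_polynomial_function.intros(1) bounded_linear_vec_nth)
  qed (auto intro: real_polynomial_function.intros(2-4))
  have basic: "sa (\<lambda>x. x \<in> S)" if "basic_semialgebraic S" for S :: "(real ^ 'n) set"
  proof -
    obtain E G P where EGP: "finite E" "finite G" "finite P" "\<And>p. p \<in> E \<union> G \<union> P \<Longrightarrow> real_poly_fun p"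
      and S: "S = {x. (\<forall>p\<in>E. p x = 0) \<and> (\<forall>p\<in>G. p x \<ge> 0) \<and> (\<forall>p\<in>P. p x > 0)}"
      using \<open>basic_semialgebraic S\<close> unfolding basic_semialgebraic_def by blast
    have "sa (\<lambda>x. (\<forall>p\<in>E. p x = 0) \<and> (\<forall>p\<in>G. p x \<ge> 0) \<and> (\<forall>p\<in>P. p x > 0))"
      by (intro sa_conj sa_Ball sa_poly_sign poly EGP) auto
    then show ?thesis by (simp add: S)
  qed
  obtain \<F> where \<F>: "finite \<F>" "\<And>S. S \<in> \<F> \<Longrightarrow> basic_semialgebraic S" "X = \<Union>\<F>"
    using assms unfolding semialgebraic_def by blast
  have "sa (\<lambda>x. \<exists>S\<in>\<F>. x \<in> S)" by (intro sa_Bex \<F> basic)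
  then show ?thesis by (simp add: \<F>(3))
qed

text \<open>At a point \<open>x\<close> far from radial, \<open>X\<close> avoids a small cone at \<open>x\<close> around the direction
  of \<open>xb - x\<close>; unlike the tangent cone itself, this is a one-line first-order condition.\<close>

definition avoids_radial_cone :: "('a::euclidean_space) set \<Rightarrow> 'a \<Rightarrow> real \<Rightarrow> 'a \<Rightarrow> bool" where
  "avoids_radial_cone X xb \<epsilon> x \<longleftrightarrow>
     (\<exists>\<delta>. 0 < \<delta> \<and> (\<forall>s y. 0 < s \<and> s < \<delta> \<and> y \<in> X \<longrightarrow>
        \<epsilon> * s * norm (xb - x) \<le> norm (y - x - s *\<^sub>R (xb - x))))"

text \<open>If the cone is entered for arbitrarily small \<open>s\<close>, the rescaled secants lie
  in the closed ball of radius \<epsilon> around the unit radial direction; by compactness a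
  subsequence converges, and its limit is a tangent vector at distance at most \<epsilon>.\<close>

lemma avoids_radial_coneI:
  fixes X :: "(real ^ 'n) set"
  assumes "x \<noteq> xb"
    and far: "\<epsilon> < infdist ((1 / norm (xb - x)) *\<^sub>R (xb - x)) (tangent_cone X x)"
  shows "avoids_radial_cone X xb \<epsilon> x"
proof (rule ccontr)
  assume contra: "\<not> ?thesis"
  define N where "N = norm (xb - x)"
  define u where "u = (1 / N) *\<^sub>R (xb - x)"
  have N: "N > 0" using \<open>x \<noteq> xb\<close> by (simp add: N_def)
  have u: "xb - x = N *\<^sub>R u" using N by (simp add: u_def)
  have "\<exists>s y. 0 < s \<and> s < 1 / real (Suc n) \<and> y \<in> X \<and> norm (y - x - s *\<^sub>R (xb - x)) < \<epsilon> * s * N" for n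
    using contra unfolding avoids_radial_cone_def N_def
    by (metis not_le of_nat_0_less_iff zero_less_Suc zero_less_divide_1_iff)
  then obtain s y where sy: "\<And>n. 0 < s n" "\<And>n. s n < 1 / real (Suc n)" "\<And>n. y n \<in> X"
    "\<And>n. norm (y n - x - s n *\<^sub>R (xb - x)) < \<epsilon> * s n * N"
    by metis
  define t where "t n = s n * N" for n
  define w where "w n = (1 / t n) *\<^sub>R (y n - x)" for n
  have t: "t n > 0" for n using sy(1) N by (simp add: t_def)
  have yw: "y n = x + t n *\<^sub>R w n" for n using t[of n] by (simp add: w_def)
  have "w n \<in> cball u \<epsilon>" for n
  proof -
    have "t n * norm (w n - u) = norm (t n *\<^sub>R (w n - u))" using t[of n] by simp
    also have "t n *\<^sub>R (w n - u) = y n - x - s n *\<^sub>R (xb - x)"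
      unfolding u yw by (simp add: t_def algebra_simps)
    finally have "t n * norm (w n - u) < t n * \<epsilon>" using sy(4)[of n] by (simp add: t_def mult_ac)
    then show ?thesis using t[of n] by (simp add: dist_norm norm_minus_commute)
  qed
  then obtain v r where v: "v \<in> cball u \<epsilon>" and r: "strict_mono r" and lim: "(w \<circ> r) \<longlonglongrightarrow> v"
    using compact_cball[of u \<epsilon>] unfolding compact_def by blast
  have "s \<longlonglongrightarrow> 0"
    by (rule tendsto_sandwich[OF _ _ tendsto_const LIMSEQ_inverse_real_of_nat])
       (auto intro!: always_eventually less_imp_le sy(1) sy(2)[unfolded divide_inverse, simplified])
  then have "t \<longlonglongrightarrow> 0" unfolding t_def using tendsto_mult_left_zero by blast
  then have tr: "(t \<circ> r) \<longlonglongrightarrow> 0" using LIMSEQ_subseq_LIMSEQ[OF _ r] by blast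
  have "(\<lambda>n. x + (t \<circ> r) n *\<^sub>R (w \<circ> r) n) \<longlonglongrightarrow> x + 0 *\<^sub>R v"
    by (intro tendsto_intros tr lim)
  then have yr: "(y \<circ> r) \<longlonglongrightarrow> x" by (simp add: o_def yw[symmetric])
  have "v \<in> tangent_cone X x"
    unfolding tangent_cone_def
    using t sy(3) tr yr lim
    by (intro CollectI exI[of _ "t \<circ> r"] exI[of _ "y \<circ> r"]) (simp add: w_def o_def)
  then have "infdist u (tangent_cone X x) \<le> dist u v" by (rule infdist_le)
  also have "\<dots> \<le> \<epsilon>" using v by simp
  finally show False using far by (simp add: u_def N_def)
qed

lemma sa_slow_variation:
  fixes f :: "real \<Rightarrow> real"
  assumes f: "sa_fun f" and "0 < d" and bound: "\<And>r. 0 < r \<Longrightarrow> r < d \<Longrightarrow> \<bar>f r\<bar> \<le> 1" and "0 < \<eta>"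
  shows "\<exists>d'>0. \<forall>r. 0 < r \<and> r < d' \<longrightarrow> (\<exists>e>0. \<forall>h. 0 < h \<and> h < e \<longrightarrow> r * \<bar>f r - f (r - h)\<bar> \<le> \<eta> * h)"
proof -
  obtain d1 where d1: "d1 > 0" "\<And>r. 0 < r \<Longrightarrow> r < d1 \<Longrightarrow>
      \<exists>e>0. \<forall>h. 0 < h \<and> h < e \<longrightarrow> r * (f r - f (r - h)) \<le> \<eta> * h"
    using sa_fun_left_slope_le[OF f \<open>0 < d\<close> bound \<open>0 < \<eta>\<close>] by auto
  have "\<bar>- f r\<bar> \<le> 1" if "0 < r" "r < d" for r using bound[OF that] by simp
  from sa_fun_left_slope_le[OF sa_fun_minus[OF f] \<open>0 < d\<close> this \<open>0 < \<eta>\<close>]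
  obtain d2 where d2: "d2 > 0" "\<And>r. 0 < r \<Longrightarrow> r < d2 \<Longrightarrow>
      \<exists>e>0. \<forall>h. 0 < h \<and> h < e \<longrightarrow> r * (- f r - - f (r - h)) \<le> \<eta> * h"
    by auto
  show ?thesis
  proof (rule exI[of _ "min d1 d2"], intro conjI allI impI)
    show "0 < min d1 d2" using d1 d2 by simp
    fix r assume r: "0 < r \<and> r < min d1 d2"
    obtain a where a: "a > 0" "\<And>h. 0 < h \<Longrightarrow> h < a \<Longrightarrow> r * (f r - f (r - h)) \<le> \<eta> * h"
      using d1(2)[of r] r by auto
    obtain b where b: "b > 0" "\<And>h. 0 < h \<Longrightarrow> h < b \<Longrightarrow> r * (- f r - - f (r - h)) \<le> \<eta> * h"
      using d2(2)[of r] r by auto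
    show "\<exists>e>0. \<forall>h. 0 < h \<and> h < e \<longrightarrow> r * \<bar>f r - f (r - h)\<bar> \<le> \<eta> * h"
      using a b by (intro exI[of _ "min a b"]) (auto simp: abs_if)
  qed
qed

lemma not_avoids_radial_cone_near:
  fixes X :: "('a::euclidean_space) set"
  assumes X: "sa (\<lambda>x. x \<in> X)" and "0 < \<epsilon>"
  shows "\<exists>d>0. \<forall>x\<in>X. x \<noteq> xb \<and> dist x xb < d \<longrightarrow> \<not> avoids_radial_cone X xb \<epsilon> x"
proof (rule ccontr)
  assume contra: "\<not> ?thesis"
  \<comment> \<open>Polar coordinates around \<open>xb\<close>, with \<open>snd z\<close> a unit
    vector: the fibres are bounded, as the choice requires.\<close>
  define P where "P z \<longleftrightarrow> 0 < fst z \<and> norm (snd z) = 1 \<and> xb + fst z *\<^sub>R snd z \<in> X \<and>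
      avoids_radial_cone X xb \<epsilon> (xb + fst z *\<^sub>R snd z)" for z :: "real \<times> 'a"
  have saP: "sa P"
    unfolding P_def avoids_radial_cone_def by (intro sa_intros sa_fun_norm sa_comp[OF X])
  have "sa (\<lambda>r. \<exists>w. P (r, w))" by (rule sa_ex[OF saP])
  from sa_real_right_constant[OF this, of 0]
  obtain d where d: "d > 0" "(\<forall>r. 0 < r \<and> r < d \<longrightarrow> (\<exists>w. P (r, w))) \<or> (\<forall>r. 0 < r \<and> r < d \<longrightarrow> \<not> (\<exists>w. P (r, w)))"
    by auto
  have "\<exists>r w. 0 < r \<and> r < d \<and> P (r, w)"
  proof -
    obtain x where x: "x \<in> X" "x \<noteq> xb" "dist x xb < d" "avoids_radial_cone X xb \<epsilon> x"
      using contra d(1) by blast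
    have "P (dist x xb, (1 / dist x xb) *\<^sub>R (x - xb))"
      using x by (simp add: P_def dist_norm)
    then show ?thesis using x by (intro exI[of _ "dist x xb"]) auto
  qed
  then have ex: "\<exists>w. P (r, w)" if "0 < r" "r < d" for r using d(2) that by blast
  have "norm w \<le> 1" if "P (r, w)" for r w using that by (simp add: P_def)
  then obtain \<omega> where \<omega>: "sa_fun \<omega>" "\<And>r. \<exists>w. P (r, w) \<Longrightarrow> P (r, \<omega> r)"
    using sa_choice[OF saP] by blast
  have P: "P (r, \<omega> r)" if "0 < r" "r < d" for r using \<omega>(2) ex that by blast
  \<comment> \<open>The shares of all coordinates add up to \<open>\<epsilon> / 2\<close>, strictly
    below the \<epsilon> of the cone.\<close>
  define \<eta> where "\<eta> = \<epsilon> / (2 * real DIM('a))"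
  have \<eta>: "\<eta> > 0" "real DIM('a) * \<eta> = \<epsilon> / 2" using \<open>0 < \<epsilon>\<close> by (simp_all add: \<eta>_def)
  have "\<exists>d'>0. \<forall>r. 0 < r \<and> r < d' \<longrightarrow>
     (\<exists>e>0. \<forall>h. 0 < h \<and> h < e \<longrightarrow> r * \<bar>\<omega> r \<bullet> b - \<omega> (r - h) \<bullet> b\<bar> \<le> \<eta> * h)" if b: "b \<in> Basis" for b
  proof (rule sa_slow_variation[OF _ d(1) _ \<eta>(1)])
    show "sa_fun (\<lambda>r. \<omega> r \<bullet> b)" by (intro sa_intros \<omega>(1))
    show "\<bar>\<omega> r \<bullet> b\<bar> \<le> 1" if "0 < r" "r < d" for r
      using P[OF that] Basis_le_norm[OF b, of "\<omega> r"] by (simp add: P_def)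
  qed
  then obtain D where D: "\<And>b. b \<in> Basis \<Longrightarrow> D b > 0" "\<And>b r. b \<in> Basis \<Longrightarrow> 0 < r \<Longrightarrow> r < D b \<Longrightarrow>
     \<exists>e>0. \<forall>h. 0 < h \<and> h < e \<longrightarrow> r * \<bar>\<omega> r \<bullet> b - \<omega> (r - h) \<bullet> b\<bar> \<le> \<eta> * h"
    by metis
  define r where "r = Min (insert d (D ` Basis)) / 2"
  have "0 < Min (insert d (D ` Basis))" using d(1) D(1) by (subst Min_gr_iff) auto
  moreover have "Min (insert d (D ` Basis)) \<le> d" "\<And>b. b \<in> Basis \<Longrightarrow> Min (insert d (D ` Basis)) \<le> D b"
    by (rule Min_le; simp)+
  ultimately have r: "0 < r" "r < d" "\<And>b. b \<in> Basis \<Longrightarrow> r < D b"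
    unfolding r_def by fastforce+
  have "\<forall>b\<in>Basis. \<exists>e>0. \<forall>h. 0 < h \<and> h < e \<longrightarrow> r * \<bar>\<omega> r \<bullet> b - \<omega> (r - h) \<bullet> b\<bar> \<le> \<eta> * h"
    using D(2) r by blast
  then obtain E where E: "\<And>b. b \<in> Basis \<Longrightarrow> E b > 0" "\<And>b h. b \<in> Basis \<Longrightarrow> 0 < h \<Longrightarrow> h < E b \<Longrightarrow>
     r * \<bar>\<omega> r \<bullet> b - \<omega> (r - h) \<bullet> b\<bar> \<le> \<eta> * h"
    by metis
  have Pr: "P (r, \<omega> r)" using P r by blast
  define x where "x = xb + r *\<^sub>R \<omega> r"
  have nx: "norm (xb - x) = r" using Pr r by (simp add: P_def x_def)
  obtain \<delta> where \<delta>: "0 < \<delta>" "\<And>s y. 0 < s \<Longrightarrow> s < \<delta> \<Longrightarrow> y \<in> X \<Longrightarrow>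
      \<epsilon> * s * norm (xb - x) \<le> norm (y - x - s *\<^sub>R (xb - x))"
    using Pr unfolding P_def avoids_radial_cone_def x_def by auto
  \<comment> \<open>\<open>h < r\<close> keeps \<open>r - h\<close> a valid radius,
    \<open>h < r * \<delta>\<close> makes \<open>h / r\<close> admissible for the cone, and
    \<open>h < E b\<close> gives the slow variation of each coordinate.\<close>
  define h where "h = Min ({r, r * \<delta>} \<union> E ` Basis) / 2"
  have "0 < Min ({r, r * \<delta>} \<union> E ` Basis)" using r(1) \<delta>(1) E(1) by (subst Min_gr_iff) auto
  moreover have "Min ({r, r * \<delta>} \<union> E ` Basis) \<le> r" "Min ({r, r * \<delta>} \<union> E ` Basis) \<le> r * \<delta>"
    "\<And>b. b \<in> Basis \<Longrightarrow> Min ({r, r * \<delta>} \<union> E ` Basis) \<le> E b"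
    by (rule Min_le; simp)+
  ultimately have h: "0 < h" "h < r" "h < r * \<delta>" "\<And>b. b \<in> Basis \<Longrightarrow> h < E b"
    unfolding h_def by fastforce+
  define v where "v = \<omega> r - \<omega> (r - h)"
  have "P (r - h, \<omega> (r - h))" using P[of "r - h"] h r by simp
  then have mem: "xb + (r - h) *\<^sub>R \<omega> (r - h) \<in> X" by (simp add: P_def)
  have s: "0 < h / r" "h / r < \<delta>" using h r by (simp_all add: field_simps)
  \<comment> \<open>As \<open>xb - x\<close> is \<open>- r\<close> times \<open>\<omega> r\<close>,
    the radial parts cancel and only the change of direction is left.\<close>
  have "xb + (r - h) *\<^sub>R \<omega> (r - h) - x - (h / r) *\<^sub>R (xb - x) = - ((r - h) *\<^sub>R v)"
    using r(1) by (simp add: x_def v_def algebra_simps)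
  then have "\<epsilon> * (h / r) * r \<le> norm ((r - h) *\<^sub>R v)"
    using \<delta>(2)[OF s mem] by (simp add: nx)
  then have "\<epsilon> * h \<le> (r - h) * norm v" using r(1) h by simp
  also have "\<dots> \<le> r * norm v" using h by (intro mult_right_mono) auto
  also have "\<dots> \<le> r * (\<Sum>b\<in>Basis. \<bar>v \<bullet> b\<bar>)"
    using r(1) by (intro mult_left_mono norm_le_l1) auto
  also have "\<dots> = (\<Sum>b\<in>Basis. r * \<bar>\<omega> r \<bullet> b - \<omega> (r - h) \<bullet> b\<bar>)"
    by (simp add: sum_distrib_left v_def inner_diff_left)
  also have "\<dots> \<le> (\<Sum>b\<in>(Basis :: 'a set). \<eta> * h)"
    by (intro sum_mono E(2) h)
  also have "\<dots> = \<epsilon> / 2 * h" using \<eta>(2) by (simp add: mult.assoc[symmetric])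
  finally show False using \<open>0 < \<epsilon>\<close> h(1) by simp
qed

theorem theorem8p5:
  fixes X :: "(real ^ 'n) set" and xb :: "real ^ 'n"
  assumes "semialgebraic X" and "xb \<in> X"
  shows "nearly_radial X xb"
  unfolding nearly_radial_def
proof (intro conjI tendstoI \<open>xb \<in> X\<close>)
  fix e :: real assume "0 < e"
  \<comment> \<open>The negated cone condition yields only a weak inequality, hence
    \<open>e / 2\<close> for a strict bound by \<open>e\<close>.\<close>
  obtain d where d: "d > 0" "\<And>x. x \<in> X \<Longrightarrow> x \<noteq> xb \<Longrightarrow> dist x xb < d \<Longrightarrow> \<not> avoids_radial_cone X xb (e / 2) x"
    using not_avoids_radial_cone_near[OF sa_semialgebraic[OF assms(1)], of "e / 2" xb] \<open>0 < e\<close> by auto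
  have "infdist ((1 / norm (xb - x)) *\<^sub>R (xb - x)) (tangent_cone X x) \<le> e / 2"
    if "x \<in> X" "x \<noteq> xb" "dist x xb < d" for x
    using avoids_radial_coneI[OF that(2)] d(2)[OF that] by (meson not_le)
  then show "\<forall>\<^sub>F x in at xb within X.
      dist (infdist ((1 / norm (xb - x)) *\<^sub>R (xb - x)) (tangent_cone X x)) 0 < e"
    unfolding eventually_at using d(1) \<open>0 < e\<close>
    by (intro exI[of _ d]) (force simp: infdist_nonneg)
qed

end
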